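(* For any directed graph $E$, the graph monoid $M(E)$ is a tame, conical, refinement monoid. In particular, it is unperforated and separative.
   Context: All monoids are commutative, written additively, and homomorphisms are monoid homomorphisms. $\mathbb{N}$ denotes the positive integers. The algebraic ordering on a monoid $M$ is: $x\le y$ iff $x+z=y$ for some $z\in M$. $M$ is a refinement monoid if whenever $x_1+x_2=y_1+y_2$ in $M$, there exist $z_{ij}\in M$ ($i,j=1,2$) with $x_i=z_{i1}+z_{i2}$ and $y_j=z_{1j}+z_{2j}$ for $i,j=1,2$. A refinement monoid is tame if it is an inductive (directed) limit, in the category of commutative monoids, of an inductive system of finitely generated refinement monoids. $M$ is conical if $x+y=0$ implies $x=y=0$. $M$ is unperforated if $mx\le my$ implies $x\le y$ for all $m\in\mathbb{N}$, $x,y\in M$. $M$ is separative if $2x=2y=x+y$ implies $x=y$. A directed graph is $E=(E^0,E^1,r,s)$ with arbitrary sets $E^0$ (vertices) and $E^1$ (arrows), and range and source maps $r,s:E^1\to E^0$. An infinite emitter is a vertex $v$ with $s^{-1}(v)$ infinite. The graph monoid $M(E)$ is the commutative monoid presented by the generators $v\in E^0$ together with generators $q_Z$, where $Z$ runs through all nonempty finite subsets of $s^{-1}(v)$ for infinite emitters $v\in E^0$, and the relations: (1) $v=\sum\{r(e)\mid e\in s^{-1}(v)\}$ for all $v\in E^0$ such that $s^{-1}(v)$ is nonempty and finite; (2) $v=\sum\{r(e)\mid e\in Z\}+q_Z$ for all infinite emitters $v\in E^0$ and all nonempty finite subsets $Z\subset s^{-1}(v)$; (3) $q_Z=\sum\{r(e)\mid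 e\in W\setminus Z\}+q_W$ for all nonempty finite sets $Z\subseteq W\subset s^{-1}(v)$, where $v\in E^0$ is an infinite emitter. *)

theory Defs
  imports "HOL-Algebra.Divisibility" "HOL-Library.Multiset" "Graph_Theory.Digraph"
begin

section \<open>Commutative monoids\<close>

text \<open>
  Commutative monoids are structures satisfying \<open>comm_monoid\<close>. The library writes
  them multiplicatively: \<open>x \<otimes> y\<close> is the sum \<open>x + y\<close>, \<open>\<one>\<close> is the zero element,
  \<open>x [^] m\<close> is the multiple \<open>m x\<close>, and \<open>x divides y\<close> is the
  algebraic ordering \<open>x \<le> y\<close>.
\<close>

definition refinement_monoid :: "('a, 'm) monoid_scheme \<Rightarrow> bool" where
  "refinement_monoid M \<longleftrightarrow> comm_monoid M \<and>
    (\<forall>x1\<in>carrier M. \<forall>x2\<in>carrier M. \<forall>y1\<in>carrier M. \<forall>y2\<in>carrier M.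
      x1 \<otimes>\<^bsub>M\<^esub> x2 = y1 \<otimes>\<^bsub>M\<^esub> y2 \<longrightarrow>
      (\<exists>z11\<in>carrier M. \<exists>z12\<in>carrier M. \<exists>z21\<in>carrier M. \<exists>z22\<in>carrier M.
        x1 = z11 \<otimes>\<^bsub>M\<^esub> z12 \<and> x2 = z21 \<otimes>\<^bsub>M\<^esub> z22 \<and>
        y1 = z11 \<otimes>\<^bsub>M\<^esub> z21 \<and> y2 = z12 \<otimes>\<^bsub>M\<^esub> z22))"

definition conical :: "('a, 'm) monoid_scheme \<Rightarrow> bool" where
  "conical M \<longleftrightarrow> (\<forall>x\<in>carrier M. \<forall>y\<in>carrier M.
    x \<otimes>\<^bsub>M\<^esub> y = \<one>\<^bsub>M\<^esub> \<longrightarrow> x = \<one>\<^bsub>M\<^esub> \<and> y = \<one>\<^bsub>M\<^esub>)"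

definition unperforated :: "('a, 'm) monoid_scheme \<Rightarrow> bool" where
  "unperforated M \<longleftrightarrow> (\<forall>m::nat. \<forall>x\<in>carrier M. \<forall>y\<in>carrier M.
    0 < m \<longrightarrow> (x [^]\<^bsub>M\<^esub> m) divides\<^bsub>M\<^esub> (y [^]\<^bsub>M\<^esub> m) \<longrightarrow> x divides\<^bsub>M\<^esub> y)"

definition separative :: "('a, 'm) monoid_scheme \<Rightarrow> bool" where
  "separative M \<longleftrightarrow> (\<forall>x\<in>carrier M. \<forall>y\<in>carrier M.
    x [^]\<^bsub>M\<^esub> (2::nat) = y [^]\<^bsub>M\<^esub> (2::nat) \<and> y [^]\<^bsub>M\<^esub> (2::nat) = x \<otimes>\<^bsub>M\<^esub> y \<longrightarrow> x = y)"

definition finitely_generated_monoid :: "('a, 'm) monoid_scheme \<Rightarrow> bool" where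
  "finitely_generated_monoid M \<longleftrightarrow>
    (\<exists>S. finite S \<and> S \<subseteq> carrier M \<and> (\<forall>H. submonoid H M \<and> S \<subseteq> H \<longrightarrow> H = carrier M))"

text \<open>For monoids, the library's \<open>hom\<close> does not require preservation of the unit.\<close>

definition monoid_hom :: "('a, 'm) monoid_scheme \<Rightarrow> ('b, 'n) monoid_scheme \<Rightarrow> ('a \<Rightarrow> 'b) set" where
  "monoid_hom M N = {h \<in> hom M N. h \<one>\<^bsub>M\<^esub> = \<one>\<^bsub>N\<^esub>}"


section \<open>Inductive limits and tame refinement monoids\<close>

definition inductive_system ::
  "'i set \<Rightarrow> 'i rel \<Rightarrow> ('i \<Rightarrow> ('b, 'm) monoid_scheme) \<Rightarrow> ('i \<Rightarrow> 'i \<Rightarrow> 'b \<Rightarrow> 'b) \<Rightarrow> bool" where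
  "inductive_system I r D \<phi> \<longleftrightarrow>
    I \<noteq> {} \<and> partial_order_on I r \<and> (\<forall>i\<in>I. \<forall>j\<in>I. \<exists>k\<in>I. (i, k) \<in> r \<and> (j, k) \<in> r) \<and>
    (\<forall>i\<in>I. comm_monoid (D i)) \<and>
    (\<forall>(i, j)\<in>r. \<phi> i j \<in> monoid_hom (D i) (D j)) \<and>
    (\<forall>i\<in>I. \<forall>x\<in>carrier (D i). \<phi> i i x = x) \<and>
    (\<forall>i j k. (i, j) \<in> r \<longrightarrow> (j, k) \<in> r \<longrightarrow>
      (\<forall>x\<in>carrier (D i). \<phi> j k (\<phi> i j x) = \<phi> i k x))"

definition cocone ::
  "'i set \<Rightarrow> 'i rel \<Rightarrow> ('i \<Rightarrow> ('b, 'm) monoid_scheme) \<Rightarrow> ('i \<Rightarrow> 'i \<Rightarrow> 'b \<Rightarrow> 'b)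
    \<Rightarrow> ('c, 'n) monoid_scheme \<Rightarrow> ('i \<Rightarrow> 'b \<Rightarrow> 'c) \<Rightarrow> bool" where
  "cocone I r D \<phi> N \<theta> \<longleftrightarrow> comm_monoid N \<and>
    (\<forall>i\<in>I. \<theta> i \<in> monoid_hom (D i) N) \<and>
    (\<forall>(i, j)\<in>r. \<forall>x\<in>carrier (D i). \<theta> j (\<phi> i j x) = \<theta> i x)"

text \<open>
  The universal property of the colimit in the category of commutative monoids, tested
  against the commutative monoids whose carrier lies in the type \<open>'u\<close>. Functions
  on carriers are only compared on the carriers.
\<close>

definition inductive_limit ::
  "'u itself \<Rightarrow> 'i set \<Rightarrow> 'i rel \<Rightarrow> ('i \<Rightarrow> ('b, 'm) monoid_scheme) \<Rightarrow> ('i \<Rightarrow> 'i \<Rightarrow> 'b \<Rightarrow> 'b)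
    \<Rightarrow> ('a, 'n) monoid_scheme \<Rightarrow> ('i \<Rightarrow> 'b \<Rightarrow> 'a) \<Rightarrow> bool" where
  "inductive_limit (_ :: 'u itself) I r D \<phi> M \<psi> \<longleftrightarrow>
    cocone I r D \<phi> M \<psi> \<and>
    (\<forall>(N :: 'u monoid) \<theta>. cocone I r D \<phi> N \<theta> \<longrightarrow>
      (\<exists>u\<in>monoid_hom M N.
        (\<forall>i\<in>I. \<forall>x\<in>carrier (D i). u (\<psi> i x) = \<theta> i x) \<and>
        (\<forall>u'\<in>monoid_hom M N. (\<forall>i\<in>I. \<forall>x\<in>carrier (D i). u' (\<psi> i x) = \<theta> i x) \<longrightarrow>
          (\<forall>a\<in>carrier M. u' a = u a))))"

text \<open>
  A definition cannot quantify over types, so the index set, the monoids of the system and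
  the test monoids are taken from the type \<open>'a list\<close>, which is infinite and contains
  a copy of \<open>'a\<close>. This is no restriction: by \<open>tame_inductive_limit\<close> below,
  an inductive system over any types may be used to prove tameness; and by
  \<open>tame_obtain_elementwise_limit\<close> and \<open>elementwise_imp_inductive_limit\<close>,
  every tame monoid has a system whose limit property holds for test monoids in every type.
\<close>

definition tame :: "('a, 'm) monoid_scheme \<Rightarrow> bool" where
  "tame M \<longleftrightarrow> refinement_monoid M \<and>
    (\<exists>(I :: 'a list set) r (D :: 'a list \<Rightarrow> 'a list monoid) \<phi> \<psi>.
      inductive_system I r D \<phi> \<and>
      (\<forall>i\<in>I. finitely_generated_monoid (D i) \<and> refinement_monoid (D i)) \<and>
      inductive_limit TYPE('a list) I r D \<phi> M \<psi>)"

section \<open>Presentations of commutative monoids\<close>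

text \<open>
  Elements of the free commutative monoid on \<open>X\<close> are the finite multisets with
  elements in \<open>X\<close>; \<open>R\<close> is a set of pairs of such multisets.
\<close>

inductive_set congruence_closure :: "'g set \<Rightarrow> 'g multiset rel \<Rightarrow> 'g multiset rel"
  for X :: "'g set" and R :: "'g multiset rel" where
  base: "(a, b) \<in> R \<Longrightarrow> (a, b) \<in> congruence_closure X R"
| refl: "set_mset a \<subseteq> X \<Longrightarrow> (a, a) \<in> congruence_closure X R"
| sym: "(a, b) \<in> congruence_closure X R \<Longrightarrow> (b, a) \<in> congruence_closure X R"
| trans: "(a, b) \<in> congruence_closure X R \<Longrightarrow> (b, c) \<in> congruence_closure X R
    \<Longrightarrow> (a, c) \<in> congruence_closure X R"
| add: "(a, b) \<in> congruence_closure X R \<Longrightarrow> set_mset c \<subseteq> X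
    \<Longrightarrow> (a + c, b + c) \<in> congruence_closure X R"

definition presented_monoid :: "'g set \<Rightarrow> 'g multiset rel \<Rightarrow> 'g multiset set monoid" where
  "presented_monoid X R =
    \<lparr>carrier = {a. set_mset a \<subseteq> X} // congruence_closure X R,
     monoid.mult = (\<lambda>A B. \<Union>a\<in>A. \<Union>b\<in>B. congruence_closure X R `` {a + b}),
     one = congruence_closure X R `` {{#}}\<rparr>"


section \<open>Graph monoids\<close>

text \<open>
  Directed graphs are \<open>wf_digraph\<close>s: \<open>verts E\<close> is the set of vertices,
  \<open>arcs E\<close> the set of arrows, \<open>tail E\<close> is the source map, \<open>head E\<close> is the
  range map and \<open>out_arcs E v\<close> is the preimage of \<open>v\<close> under the source map.
\<close>

definition infinite_emitter :: "('v, 'e) pre_digraph \<Rightarrow> 'v \<Rightarrow> bool" where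
  "infinite_emitter E v \<longleftrightarrow> v \<in> verts E \<and> infinite (out_arcs E v)"

text \<open>
  The generator \<open>Q Z\<close> need not record the infinite emitter \<open>v\<close>, as it is the source of
  every arrow in the nonempty set \<open>Z\<close>.
\<close>

datatype ('v, 'e) generator = Vertex 'v | Q "'e set"

definition graph_generators :: "('v, 'e) pre_digraph \<Rightarrow> ('v, 'e) generator set" where
  "graph_generators E = Vertex ` verts E \<union>
    {Q Z | v Z. infinite_emitter E v \<and> Z \<subseteq> out_arcs E v \<and> finite Z \<and> Z \<noteq> {}}"

definition range_sum :: "('v, 'e) pre_digraph \<Rightarrow> 'e set \<Rightarrow> ('v, 'e) generator multiset" where
  "range_sum E Z = (\<Sum>e\<in>Z. {#Vertex (head E e)#})"

definition graph_relations :: "('v, 'e) pre_digraph \<Rightarrow> ('v, 'e) generator multiset rel" where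
  "graph_relations E =
    {({#Vertex v#}, range_sum E (out_arcs E v)) | v.
        v \<in> verts E \<and> out_arcs E v \<noteq> {} \<and> finite (out_arcs E v)} \<union>
    {({#Vertex v#}, range_sum E Z + {#Q Z#}) | v Z.
        infinite_emitter E v \<and> Z \<subseteq> out_arcs E v \<and> finite Z \<and> Z \<noteq> {}} \<union>
    {({#Q Z#}, range_sum E (W - Z) + {#Q W#}) | v Z W.
        infinite_emitter E v \<and> Z \<subseteq> W \<and> W \<subseteq> out_arcs E v \<and> finite W \<and> Z \<noteq> {}}"

definition graph_monoid ::
    "('v, 'e) pre_digraph \<Rightarrow> ('v, 'e) generator multiset set monoid" where
  "graph_monoid E = presented_monoid (graph_generators E) (graph_relations E)"


section \<open>Presented monoids are commutative monoids\<close>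

lemma congruence_closure_subset:
  assumes "R \<subseteq> {a. set_mset a \<subseteq> X} \<times> {a. set_mset a \<subseteq> X}"
  shows "congruence_closure X R \<subseteq> {a. set_mset a \<subseteq> X} \<times> {a. set_mset a \<subseteq> X}"
proof -
  have "set_mset a \<subseteq> X \<and> set_mset b \<subseteq> X" if "(a, b) \<in> congruence_closure X R" for a b
    using that by (induction rule: congruence_closure.induct) (use assms in auto)
  then show ?thesis by auto
qed

lemma congruence_closure_equiv:
  assumes "R \<subseteq> {a. set_mset a \<subseteq> X} \<times> {a. set_mset a \<subseteq> X}"
  shows "equiv {a. set_mset a \<subseteq> X} (congruence_closure X R)"
  using congruence_closure_subset[OF assms]
  by (intro equivI)
    (auto simp: refl_on_def sym_def trans_def intro: congruence_closure.intros)

lemma presented_monoid_mult: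
  assumes R: "R \<subseteq> {a. set_mset a \<subseteq> X} \<times> {a. set_mset a \<subseteq> X}"
    and ab: "set_mset a \<subseteq> X" "set_mset b \<subseteq> X"
  shows "congruence_closure X R `` {a} \<otimes>\<^bsub>presented_monoid X R\<^esub> congruence_closure X R `` {b} =
    congruence_closure X R `` {a + b}"
proof -
  let ?c = "congruence_closure X R"
  note eq = congruence_closure_equiv[OF R]
  have "?c `` {a' + b'} = ?c `` {a + b}" if "(a, a') \<in> ?c" "(b, b') \<in> ?c" for a' b'
  proof -
    have "set_mset a' \<subseteq> X" using that congruence_closure_subset[OF R] by blast
    then have "(a + b, a' + b) \<in> ?c" "(b + a', b' + a') \<in> ?c"
      using that ab by (auto intro: congruence_closure.add)
    then have "(a + b, a' + b') \<in> ?c"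
      by (metis add.commute congruence_closure.trans)
    then show ?thesis using equiv_class_eq[OF eq] by metis
  qed
  moreover have "(a, a) \<in> ?c" "(b, b) \<in> ?c" using ab by (auto intro: congruence_closure.refl)
  ultimately have "(\<Union>a'\<in>?c `` {a}. \<Union>b'\<in>?c `` {b}. ?c `` {a' + b'}) = ?c `` {a + b}"
    by blast
  then show ?thesis by (simp add: presented_monoid_def)
qed

lemma presented_monoid_comm_monoid:
  assumes R: "R \<subseteq> {a. set_mset a \<subseteq> X} \<times> {a. set_mset a \<subseteq> X}"
  shows "comm_monoid (presented_monoid X R)"
proof -
  let ?c = "congruence_closure X R" and ?M = "presented_monoid X R"
  have car: "p \<in> carrier ?M \<longleftrightarrow> (\<exists>a. set_mset a \<subseteq> X \<and> p = ?c `` {a})" for p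
    by (auto simp: presented_monoid_def quotient_def)
  have one: "\<one>\<^bsub>?M\<^esub> = ?c `` {{#}}" by (simp add: presented_monoid_def)
  note mult = presented_monoid_mult[OF R]
  show ?thesis
  proof (rule comm_monoidI)
    fix p q assume "p \<in> carrier ?M" "q \<in> carrier ?M"
    then obtain a b where ab: "set_mset a \<subseteq> X" "set_mset b \<subseteq> X" "p = ?c `` {a}" "q = ?c `` {b}"
      unfolding car by blast
    show "p \<otimes>\<^bsub>?M\<^esub> q \<in> carrier ?M"
      unfolding car using ab mult by (intro exI[of _ "a + b"]) simp
    show "p \<otimes>\<^bsub>?M\<^esub> q = q \<otimes>\<^bsub>?M\<^esub> p" using ab mult by (simp add: add.commute)
  next
    show "\<one>\<^bsub>?M\<^esub> \<in> carrier ?M" unfolding car one by (intro exI[of _ "{#}"]) simp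
  next
    fix p q s assume "p \<in> carrier ?M" "q \<in> carrier ?M" "s \<in> carrier ?M"
    then obtain a b d where "set_mset a \<subseteq> X" "set_mset b \<subseteq> X" "set_mset d \<subseteq> X"
        "p = ?c `` {a}" "q = ?c `` {b}" "s = ?c `` {d}"
      unfolding car by blast
    then show "p \<otimes>\<^bsub>?M\<^esub> q \<otimes>\<^bsub>?M\<^esub> s = p \<otimes>\<^bsub>?M\<^esub> (q \<otimes>\<^bsub>?M\<^esub> s)"
      by (simp add: mult add.assoc)
  next
    fix p assume "p \<in> carrier ?M"
    then show "\<one>\<^bsub>?M\<^esub> \<otimes>\<^bsub>?M\<^esub> p = p" unfolding car one using mult[of "{#}"] by auto
  qed
qed

lemma set_mset_range_sum: "finite Z \<Longrightarrow> set_mset (range_sum E Z) = (\<lambda>e. Vertex (head E e)) ` Z"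
  unfolding range_sum_def by (induction Z rule: finite_induct) auto

lemma graph_monoid_comm_monoid:
  assumes "wf_digraph E"
  shows "comm_monoid (graph_monoid E)"
proof -
  interpret wf_digraph E by fact
  have rs: "set_mset (range_sum E Z) \<subseteq> graph_generators E"
    if "finite Z" "Z \<subseteq> out_arcs E v" for Z v
    using that by (auto simp: set_mset_range_sum graph_generators_def)
  have v: "Vertex v \<in> graph_generators E" if "v \<in> verts E" for v
    using that by (simp add: graph_generators_def)
  have q: "Q Z \<in> graph_generators E"
    if "infinite_emitter E v" "Z \<subseteq> out_arcs E v" "finite Z" "Z \<noteq> {}" for Z v
    using that unfolding graph_generators_def by blast
  have ie: "v \<in> verts E" if "infinite_emitter E v" for v
    using that by (simp add: infinite_emitter_def)
  have "set_mset a \<subseteq> graph_generators E \<and> set_mset b \<subseteq> graph_generators E"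
    if "(a, b) \<in> graph_relations E" for a b
    using that unfolding graph_relations_def
  proof (elim UnE CollectE exE conjE Pair_inject, goal_cases)
    case (1 w)
    then show ?case using rs[of "out_arcs E w" w] v by simp
  next
    case (2 w Z)
    then show ?case using rs[of Z w] q[of w Z] v ie by simp
  next
    case (3 w Z W)
    then have "finite Z" "Z \<subseteq> out_arcs E w" "W \<noteq> {}" "W - Z \<subseteq> out_arcs E w" by (auto intro: finite_subset)
    then show ?case using 3 rs[of "W - Z" w] q[of w Z] q[of w W] by simp
  qed
  then show ?thesis
    unfolding graph_monoid_def by (intro presented_monoid_comm_monoid) auto
qed

section \<open>Independence of the choice of types in the definition of tameness\<close>

definition elementwise_limit ::
  "'i set \<Rightarrow> 'i rel \<Rightarrow> ('i \<Rightarrow> ('b, 'm) monoid_scheme) \<Rightarrow> ('i \<Rightarrow> 'i \<Rightarrow> 'b \<Rightarrow> 'b)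
    \<Rightarrow> ('a, 'n) monoid_scheme \<Rightarrow> ('i \<Rightarrow> 'b \<Rightarrow> 'a) \<Rightarrow> bool" where
  "elementwise_limit I r D \<phi> M \<psi> \<longleftrightarrow> cocone I r D \<phi> M \<psi> \<and>
    (\<forall>a\<in>carrier M. \<exists>i\<in>I. \<exists>x\<in>carrier (D i). \<psi> i x = a) \<and>
    (\<forall>i\<in>I. \<forall>x\<in>carrier (D i). \<forall>y\<in>carrier (D i).
      \<psi> i x = \<psi> i y \<longrightarrow> (\<exists>j. (i, j) \<in> r \<and> \<phi> i j x = \<phi> i j y))"

lemma monoid_homD:
  assumes "h \<in> monoid_hom M N"
  shows "x \<in> carrier M \<Longrightarrow> h x \<in> carrier N"
    and "x \<in> carrier M \<Longrightarrow> y \<in> carrier M \<Longrightarrow> h (x \<otimes>\<^bsub>M\<^esub> y) = h x \<otimes>\<^bsub>N\<^esub> h y"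
    and "h \<one>\<^bsub>M\<^esub> = \<one>\<^bsub>N\<^esub>"
  using assms by (auto simp: monoid_hom_def hom_def)

lemma monoid_homI:
  assumes "\<And>x. x \<in> carrier M \<Longrightarrow> h x \<in> carrier N"
    and "\<And>x y. x \<in> carrier M \<Longrightarrow> y \<in> carrier M \<Longrightarrow> h (x \<otimes>\<^bsub>M\<^esub> y) = h x \<otimes>\<^bsub>N\<^esub> h y"
    and "h \<one>\<^bsub>M\<^esub> = \<one>\<^bsub>N\<^esub>"
  shows "h \<in> monoid_hom M N"
  using assms by (auto simp: monoid_hom_def hom_def)

lemma comm_monoid_closed:
  assumes "comm_monoid M"
  shows "\<one>\<^bsub>M\<^esub> \<in> carrier M"
    and "x \<in> carrier M \<Longrightarrow> y \<in> carrier M \<Longrightarrow> x \<otimes>\<^bsub>M\<^esub> y \<in> carrier M"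
proof -
  interpret comm_monoid M by fact
  show "\<one>\<^bsub>M\<^esub> \<in> carrier M" by simp
  show "x \<in> carrier M \<Longrightarrow> y \<in> carrier M \<Longrightarrow> x \<otimes>\<^bsub>M\<^esub> y \<in> carrier M" by simp
qed

lemma inductive_systemD:
  assumes "inductive_system I r D \<phi>"
  shows "I \<noteq> {}" and "(i, j) \<in> r \<Longrightarrow> i \<in> I" and "(i, j) \<in> r \<Longrightarrow> j \<in> I"
    and "i \<in> I \<Longrightarrow> (i, i) \<in> r"
    and "(i, j) \<in> r \<Longrightarrow> (j, k) \<in> r \<Longrightarrow> (i, k) \<in> r"
    and "(i, j) \<in> r \<Longrightarrow> (j, i) \<in> r \<Longrightarrow> i = j"
    and "i \<in> I \<Longrightarrow> j \<in> I \<Longrightarrow> \<exists>k. (i, k) \<in> r \<and> (j, k) \<in> r"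
    and "i \<in> I \<Longrightarrow> comm_monoid (D i)"
    and "(i, j) \<in> r \<Longrightarrow> \<phi> i j \<in> monoid_hom (D i) (D j)"
    and "i \<in> I \<Longrightarrow> x \<in> carrier (D i) \<Longrightarrow> \<phi> i i x = x"
    and "(i, j) \<in> r \<Longrightarrow> (j, k) \<in> r \<Longrightarrow> x \<in> carrier (D i) \<Longrightarrow> \<phi> j k (\<phi> i j x) = \<phi> i k x"
proof -
  have po: "partial_order_on I r"
    using assms by (simp add: inductive_system_def)
  show "I \<noteq> {}" using assms by (simp add: inductive_system_def)
  show "(i, j) \<in> r \<Longrightarrow> i \<in> I" "(i, j) \<in> r \<Longrightarrow> j \<in> I" "i \<in> I \<Longrightarrow> (i, i) \<in> r"
    using po by (auto simp: partial_order_on_def preorder_on_def refl_on_def)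
  show "(i, j) \<in> r \<Longrightarrow> (j, k) \<in> r \<Longrightarrow> (i, k) \<in> r"
    using po unfolding partial_order_on_def preorder_on_def by (meson transD)
  show "(i, j) \<in> r \<Longrightarrow> (j, i) \<in> r \<Longrightarrow> i = j"
    using po unfolding partial_order_on_def by (meson antisymD)
  show "i \<in> I \<Longrightarrow> j \<in> I \<Longrightarrow> \<exists>k. (i, k) \<in> r \<and> (j, k) \<in> r"
    "i \<in> I \<Longrightarrow> comm_monoid (D i)"
    "(i, j) \<in> r \<Longrightarrow> \<phi> i j \<in> monoid_hom (D i) (D j)"
    "i \<in> I \<Longrightarrow> x \<in> carrier (D i) \<Longrightarrow> \<phi> i i x = x"
    "(i, j) \<in> r \<Longrightarrow> (j, k) \<in> r \<Longrightarrow> x \<in> carrier (D i) \<Longrightarrow> \<phi> j k (\<phi> i j x) = \<phi> i k x"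
    using assms unfolding inductive_system_def by blast+
qed

lemma coconeD:
  assumes "cocone I r D \<phi> N \<theta>"
  shows "comm_monoid N" and "i \<in> I \<Longrightarrow> \<theta> i \<in> monoid_hom (D i) N"
    and "(i, j) \<in> r \<Longrightarrow> x \<in> carrier (D i) \<Longrightarrow> \<theta> j (\<phi> i j x) = \<theta> i x"
  using assms by (auto simp: cocone_def)

lemma elementwise_imp_inductive_limit:
  assumes sys: "inductive_system I r D \<phi>" and lim: "elementwise_limit I r D \<phi> M \<psi>"
  shows "inductive_limit TYPE('u) I r D \<phi> M \<psi>"
proof -
  note S = inductive_systemD[OF sys]
  have cM: "cocone I r D \<phi> M \<psi>"
    and surj: "\<And>a. a \<in> carrier M \<Longrightarrow> \<exists>i\<in>I. \<exists>x\<in>carrier (D i). \<psi> i x = a"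
    and idn: "\<And>i x y. i \<in> I \<Longrightarrow> x \<in> carrier (D i) \<Longrightarrow> y \<in> carrier (D i) \<Longrightarrow> \<psi> i x = \<psi> i y \<Longrightarrow>
        \<exists>j. (i, j) \<in> r \<and> \<phi> i j x = \<phi> i j y"
    using lim by (auto simp: elementwise_limit_def)
  have "\<exists>u\<in>monoid_hom M N.
        (\<forall>i\<in>I. \<forall>x\<in>carrier (D i). u (\<psi> i x) = \<theta> i x) \<and>
        (\<forall>u'\<in>monoid_hom M N. (\<forall>i\<in>I. \<forall>x\<in>carrier (D i). u' (\<psi> i x) = \<theta> i x) \<longrightarrow>
          (\<forall>a\<in>carrier M. u' a = u a))"
    if cN: "cocone I r D \<phi> N \<theta>" for N :: "'u monoid" and \<theta>
  proof -
    have wd: "\<theta> i x = \<theta> j y"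
      if ij: "i \<in> I" "x \<in> carrier (D i)" "j \<in> I" "y \<in> carrier (D j)" and e: "\<psi> i x = \<psi> j y"
      for i j x y
    proof -
      obtain k where k: "(i, k) \<in> r" "(j, k) \<in> r" using S(7) ij by blast
      have ki: "k \<in> I" using k S(3) by blast
      have x': "\<phi> i k x \<in> carrier (D k)" "\<phi> j k y \<in> carrier (D k)"
        using monoid_homD(1)[OF S(9)] k ij by simp_all
      have "\<psi> k (\<phi> i k x) = \<psi> k (\<phi> j k y)"
        using coconeD(3)[OF cM] k ij e by simp
      then obtain l where l: "(k, l) \<in> r" "\<phi> k l (\<phi> i k x) = \<phi> k l (\<phi> j k y)"
        using idn ki x' by blast
      have "\<theta> i x = \<theta> l (\<phi> k l (\<phi> i k x))"
        using coconeD(3)[OF cN] k l(1) ij x' by simp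
      also have "\<dots> = \<theta> l (\<phi> k l (\<phi> j k y))"
        by (simp only: l(2))
      also have "\<dots> = \<theta> j y"
        using coconeD(3)[OF cN] k l(1) ij x' by simp
      finally show ?thesis .
    qed
    define P where "P a p \<longleftrightarrow> fst p \<in> I \<and> snd p \<in> carrier (D (fst p)) \<and> \<psi> (fst p) (snd p) = a" for a p
    define u where "u a = (let p = SOME p. P a p in \<theta> (fst p) (snd p))" for a
    have u: "u (\<psi> i x) = \<theta> i x" if "i \<in> I" "x \<in> carrier (D i)" for i x
    proof -
      have "P (\<psi> i x) (i, x)" using that by (simp add: P_def)
      then have "P (\<psi> i x) (SOME p. P (\<psi> i x) p)" by (rule someI)
      then show ?thesis unfolding u_def Let_def using wd that unfolding P_def by blast
    qed
    have "u \<in> monoid_hom M N"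
    proof (rule monoid_homI)
      fix a assume "a \<in> carrier M"
      then obtain i x where "i \<in> I" "x \<in> carrier (D i)" "\<psi> i x = a" using surj by blast
      then show "u a \<in> carrier N" using u monoid_homD(1)[OF coconeD(2)[OF cN]] by auto
    next
      fix a b assume "a \<in> carrier M" "b \<in> carrier M"
      then obtain i x j y where ij: "i \<in> I" "x \<in> carrier (D i)" "\<psi> i x = a"
          "j \<in> I" "y \<in> carrier (D j)" "\<psi> j y = b" using surj by meson
      then obtain k where k: "(i, k) \<in> r" "(j, k) \<in> r" using S(7) by blast
      have ki: "k \<in> I" using k S(3) by blast
      define x' y' where "x' = \<phi> i k x" and "y' = \<phi> j k y"
      have c: "x' \<in> carrier (D k)" "y' \<in> carrier (D k)"
        using monoid_homD(1)[OF S(9)] k ij unfolding x'_def y'_def by simp_all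
      have ab: "a = \<psi> k x'" "b = \<psi> k y'"
        unfolding x'_def y'_def using coconeD(3)[OF cM] k ij by auto
      have c2: "x' \<otimes>\<^bsub>D k\<^esub> y' \<in> carrier (D k)"
        using S(8)[OF ki] c by (simp add: comm_monoid_closed)
      have "a \<otimes>\<^bsub>M\<^esub> b = \<psi> k (x' \<otimes>\<^bsub>D k\<^esub> y')"
        using ab monoid_homD(2)[OF coconeD(2)[OF cM ki]] c by simp
      then show "u (a \<otimes>\<^bsub>M\<^esub> b) = u a \<otimes>\<^bsub>N\<^esub> u b"
        using u ki c c2 ab monoid_homD(2)[OF coconeD(2)[OF cN ki]] by simp
    next
      obtain i where i: "i \<in> I" using S(1) by blast
      have "\<one>\<^bsub>D i\<^esub> \<in> carrier (D i)"
        using S(8)[OF i] by (simp add: comm_monoid_closed)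
      then have "u (\<psi> i \<one>\<^bsub>D i\<^esub>) = \<theta> i \<one>\<^bsub>D i\<^esub>" using u i by blast
      then show "u \<one>\<^bsub>M\<^esub> = \<one>\<^bsub>N\<^esub>"
        using monoid_homD(3)[OF coconeD(2)[OF cM i]] monoid_homD(3)[OF coconeD(2)[OF cN i]] by simp
    qed
    moreover have "\<forall>u'\<in>monoid_hom M N. (\<forall>i\<in>I. \<forall>x\<in>carrier (D i). u' (\<psi> i x) = \<theta> i x) \<longrightarrow>
          (\<forall>a\<in>carrier M. u' a = u a)"
      using surj u by metis
    ultimately show ?thesis using u by blast
  qed
  then show ?thesis using cM by (simp add: inductive_limit_def)
qed

definition transport :: "('b \<Rightarrow> 'c) \<Rightarrow> ('b, 'm) monoid_scheme \<Rightarrow> 'c monoid" where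
  "transport f A =
    \<lparr>carrier = f ` carrier A,
     monoid.mult = (\<lambda>x y. f (inv_into (carrier A) f x \<otimes>\<^bsub>A\<^esub> inv_into (carrier A) f y)),
     one = f \<one>\<^bsub>A\<^esub>\<rparr>"

lemma transport_simps:
  "carrier (transport f A) = f ` carrier A" "\<one>\<^bsub>transport f A\<^esub> = f \<one>\<^bsub>A\<^esub>"
  "inj_on f (carrier A) \<Longrightarrow> x \<in> carrier A \<Longrightarrow> y \<in> carrier A \<Longrightarrow>
    f x \<otimes>\<^bsub>transport f A\<^esub> f y = f (x \<otimes>\<^bsub>A\<^esub> y)"
  by (simp_all add: transport_def)

lemma transport_hom:
  assumes "inj_on f (carrier A)"
  shows "f \<in> monoid_hom A (transport f A)"
  using assms by (auto intro!: monoid_homI simp: transport_simps)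

lemma transport_comm_monoid:
  assumes "inj_on f (carrier A)" "comm_monoid A"
  shows "comm_monoid (transport f A)"
proof -
  interpret comm_monoid A by fact
  show ?thesis
    by (rule comm_monoidI) (use assms(1) in \<open>auto simp: transport_simps m_ac\<close>)
qed

lemma transport_inv_hom:
  assumes "inj_on f (carrier A)" "comm_monoid A"
  shows "inv_into (carrier A) f \<in> monoid_hom (transport f A) A"
proof -
  interpret comm_monoid A by fact
  show ?thesis
    by (rule monoid_homI) (use assms(1) in \<open>auto simp: transport_simps\<close>)
qed

lemma transport_refinement:
  assumes f: "inj_on f (carrier A)" and "refinement_monoid A"
  shows "refinement_monoid (transport f A)"
proof -
  have cm: "comm_monoid A" using assms(2) by (simp add: refinement_monoid_def)
  interpret comm_monoid A by fact
  have *: "\<exists>z11\<in>carrier A. \<exists>z12\<in>carrier A. \<exists>z21\<in>carrier A. \<exists>z22\<in>carrier A.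
        x1 = z11 \<otimes>\<^bsub>A\<^esub> z12 \<and> x2 = z21 \<otimes>\<^bsub>A\<^esub> z22 \<and> y1 = z11 \<otimes>\<^bsub>A\<^esub> z21 \<and> y2 = z12 \<otimes>\<^bsub>A\<^esub> z22"
    if "x1 \<in> carrier A" "x2 \<in> carrier A" "y1 \<in> carrier A" "y2 \<in> carrier A"
      "x1 \<otimes>\<^bsub>A\<^esub> x2 = y1 \<otimes>\<^bsub>A\<^esub> y2" for x1 x2 y1 y2
    using assms(2) that unfolding refinement_monoid_def by blast
  show ?thesis unfolding refinement_monoid_def
  proof (intro conjI ballI impI, goal_cases)
    case 1 show ?case by (rule transport_comm_monoid[OF f cm])
  next
    case (2 x1 x2 y1 y2)
    then obtain a1 a2 b1 b2 where ab: "a1 \<in> carrier A" "a2 \<in> carrier A" "b1 \<in> carrier A" "b2 \<in> carrier A"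
      "x1 = f a1" "x2 = f a2" "y1 = f b1" "y2 = f b2" by (auto simp: transport_simps)
    then have "f (a1 \<otimes>\<^bsub>A\<^esub> a2) = f (b1 \<otimes>\<^bsub>A\<^esub> b2)" using 2 f by (simp add: transport_simps)
    then have "a1 \<otimes>\<^bsub>A\<^esub> a2 = b1 \<otimes>\<^bsub>A\<^esub> b2" using f ab by (auto dest: inj_onD)
    then obtain z11 z12 z21 z22 where "z11 \<in> carrier A" "z12 \<in> carrier A" "z21 \<in> carrier A"
      "z22 \<in> carrier A" "a1 = z11 \<otimes>\<^bsub>A\<^esub> z12" "a2 = z21 \<otimes>\<^bsub>A\<^esub> z22" "b1 = z11 \<otimes>\<^bsub>A\<^esub> z21" "b2 = z12 \<otimes>\<^bsub>A\<^esub> z22"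
      using *[OF ab(1-4)] by blast
    then show ?case using ab(5-8) f
      by (intro bexI[of _ "f z11"] bexI[of _ "f z12"] bexI[of _ "f z21"] bexI[of _ "f z22"])
        (simp_all add: transport_simps)
  qed
qed

lemma transport_fg:
  assumes f: "inj_on f (carrier A)" and cm: "comm_monoid A" and "finitely_generated_monoid A"
  shows "finitely_generated_monoid (transport f A)"
proof -
  interpret comm_monoid A by fact
  obtain S where S: "finite S" "S \<subseteq> carrier A" "\<And>H. submonoid H A \<Longrightarrow> S \<subseteq> H \<Longrightarrow> H = carrier A"
    using assms(3) by (auto simp: finitely_generated_monoid_def)
  have "H = carrier (transport f A)" if H: "submonoid H (transport f A)" "f ` S \<subseteq> H" for H
  proof -
    let ?K = "{x \<in> carrier A. f x \<in> H}"
    interpret H: submonoid H "transport f A" by fact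
    have "submonoid ?K A"
    proof
      show "?K \<subseteq> carrier A" by blast
      show "\<one>\<^bsub>A\<^esub> \<in> ?K" using H.one_closed by (simp add: transport_simps)
      fix x y assume "x \<in> ?K" "y \<in> ?K"
      then show "x \<otimes>\<^bsub>A\<^esub> y \<in> ?K"
        using H.m_closed[of "f x" "f y"] f by (simp add: transport_simps)
    qed
    then have "?K = carrier A" using S(2,3) H(2) by blast
    then show ?thesis using H.subset by (auto simp: transport_simps)
  qed
  then show ?thesis unfolding finitely_generated_monoid_def
    using S(1,2) by (intro exI[of _ "f ` S"]) (auto simp: transport_simps)
qed

lemma elementwise_restrict:
  assumes sys: "inductive_system I r D \<phi>" and lim: "elementwise_limit I r D \<phi> M \<psi>"
    and J: "J \<subseteq> I" "J \<noteq> {}"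
    and dir: "\<And>i j. i \<in> J \<Longrightarrow> j \<in> J \<Longrightarrow> \<exists>k\<in>J. (i, k) \<in> r \<and> (j, k) \<in> r"
    and surj: "\<And>a. a \<in> carrier M \<Longrightarrow> \<exists>i\<in>J. \<exists>x\<in>carrier (D i). \<psi> i x = a"
    and idn: "\<And>i x y. i \<in> J \<Longrightarrow> x \<in> carrier (D i) \<Longrightarrow> y \<in> carrier (D i) \<Longrightarrow> \<psi> i x = \<psi> i y \<Longrightarrow>
        \<exists>j\<in>J. (i, j) \<in> r \<and> \<phi> i j x = \<phi> i j y"
  shows "inductive_system J (r \<inter> J \<times> J) D \<phi>" and "elementwise_limit J (r \<inter> J \<times> J) D \<phi> M \<psi>"
proof -
  note S = inductive_systemD[OF sys]
  have po: "partial_order_on J (r \<inter> J \<times> J)"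
    unfolding partial_order_on_def preorder_on_def
  proof (intro conjI)
    show "refl_on J (r \<inter> J \<times> J)" using S(4) J(1) by (auto simp: refl_on_def)
    show "trans (r \<inter> J \<times> J)" using S(5) unfolding trans_def by blast
    show "antisym (r \<inter> J \<times> J)" using S(6) unfolding antisym_def by blast
  qed auto
  show "inductive_system J (r \<inter> J \<times> J) D \<phi>"
    unfolding inductive_system_def
  proof (intro conjI)
    show "\<forall>i\<in>J. \<forall>j\<in>J. \<exists>k\<in>J. (i, k) \<in> r \<inter> J \<times> J \<and> (j, k) \<in> r \<inter> J \<times> J"
      using dir by fast
  qed (use po J S(8-11) in auto)
  have c: "cocone I r D \<phi> M \<psi>" using lim by (simp add: elementwise_limit_def)
  show "elementwise_limit J (r \<inter> J \<times> J) D \<phi> M \<psi>"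
    unfolding elementwise_limit_def
  proof (intro conjI)
    show "cocone J (r \<inter> J \<times> J) D \<phi> M \<psi>"
      using coconeD[OF c] J(1) unfolding cocone_def by auto
    show "\<forall>a\<in>carrier M. \<exists>i\<in>J. \<exists>x\<in>carrier (D i). \<psi> i x = a" using surj by blast
    show "\<forall>i\<in>J. \<forall>x\<in>carrier (D i). \<forall>y\<in>carrier (D i).
      \<psi> i x = \<psi> i y \<longrightarrow> (\<exists>j. (i, j) \<in> r \<inter> J \<times> J \<and> \<phi> i j x = \<phi> i j y)"
      using idn by fast
  qed
qed

lemma elementwise_transport:
  fixes f :: "'i \<Rightarrow> 'j" and c :: "'i \<Rightarrow> 'b \<Rightarrow> 'd" and D :: "'i \<Rightarrow> ('b, 'm) monoid_scheme"
  assumes sys: "inductive_system I r D \<phi>" and lim: "elementwise_limit I r D \<phi> M \<psi>"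
    and f: "inj_on f I" and c: "\<And>i. i \<in> I \<Longrightarrow> inj_on (c i) (carrier (D i))"
  shows "\<exists>(I' :: 'j set) r' D' \<phi>' \<psi>'. inductive_system I' r' D' \<phi>' \<and>
      elementwise_limit I' r' D' \<phi>' M \<psi>' \<and>
      (\<forall>p\<in>I'. \<exists>i\<in>I. D' p = transport (c i) (D i))"
proof -
  note S = inductive_systemD[OF sys]
  define g where "g = inv_into I f"
  define d where "d i = inv_into (carrier (D i)) (c i)" for i
  define D' where "D' p = transport (c (g p)) (D (g p))" for p
  define \<phi>' where "\<phi>' p q x = c (g q) (\<phi> (g p) (g q) (d (g p) x))" for p q x
  define \<psi>' where "\<psi>' p x = \<psi> (g p) (d (g p) x)" for p x
  define r' where "r' = map_prod f f ` r"
  have g: "g (f i) = i" if "i \<in> I" for i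
    using that f by (simp add: g_def)
  have d: "d i (c i x) = x" if "i \<in> I" "x \<in> carrier (D i)" for i x
    using that c by (simp add: d_def)
  have c': "c i x = c i y \<longleftrightarrow> x = y" if "i \<in> I" "x \<in> carrier (D i)" "y \<in> carrier (D i)" for i x y
    using that d by metis
  have D': "D' (f i) = transport (c i) (D i)" if "i \<in> I" for i
    using that g by (simp add: D'_def)
  have car: "carrier (D' (f i)) = c i ` carrier (D i)" if "i \<in> I" for i
    using that D' by (simp add: transport_simps)
  have one: "\<one>\<^bsub>D' (f i)\<^esub> = c i \<one>\<^bsub>D i\<^esub>" if "i \<in> I" for i
    using that D' by (simp add: transport_simps)
  have mult: "c i x \<otimes>\<^bsub>D' (f i)\<^esub> c i y = c i (x \<otimes>\<^bsub>D i\<^esub> y)"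
    if "i \<in> I" "x \<in> carrier (D i)" "y \<in> carrier (D i)" for i x y
    using that D' c by (simp add: transport_simps)
  have phi': "\<phi>' (f i) (f j) (c i x) = c j (\<phi> i j x)" if "i \<in> I" "j \<in> I" "x \<in> carrier (D i)" for i j x
    using that g d by (simp add: \<phi>'_def)
  have psi': "\<psi>' (f i) (c i x) = \<psi> i x" if "i \<in> I" "x \<in> carrier (D i)" for i x
    using that g d by (simp add: \<psi>'_def)
  have r'E: "\<exists>i j. p = f i \<and> q = f j \<and> (i, j) \<in> r \<and> i \<in> I \<and> j \<in> I" if "(p, q) \<in> r'" for p q
    using that S(2,3) unfolding r'_def by (auto simp: image_iff map_prod_def) blast
  have r'I: "(f i, f j) \<in> r'" if "(i, j) \<in> r" for i j
    using that unfolding r'_def by force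
  have r'D: "(i, j) \<in> r" if "(f i, f j) \<in> r'" "i \<in> I" "j \<in> I" for i j
    using r'E[OF that(1)] that(2,3) f by (auto dest: inj_onD)
  have cl: "\<phi> i j x \<in> carrier (D j)" if "(i, j) \<in> r" "x \<in> carrier (D i)" for i j x
    using monoid_homD(1)[OF S(9)] that by blast
  have opcl: "\<one>\<^bsub>D i\<^esub> \<in> carrier (D i)"
     "x \<in> carrier (D i) \<Longrightarrow> y \<in> carrier (D i) \<Longrightarrow> x \<otimes>\<^bsub>D i\<^esub> y \<in> carrier (D i)" if "i \<in> I" for i x y
    using comm_monoid_closed[OF S(8)[OF that]] by blast+
  have po: "partial_order_on (f ` I) r'"
    unfolding partial_order_on_def preorder_on_def
  proof (intro conjI)
    show "r' \<subseteq> f ` I \<times> f ` I" unfolding r'_def using S(2,3) by auto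
    show "refl_on (f ` I) r'" using S(4) r'I by (auto simp: refl_on_def)
    show "trans r'"
    proof (rule transI)
      fix p q s assume "(p, q) \<in> r'" "(q, s) \<in> r'"
      then obtain i j j' k where "p = f i" "q = f j" "q = f j'" "s = f k"
        "(i, j) \<in> r" "(j', k) \<in> r" "i \<in> I" "j \<in> I" "j' \<in> I" "k \<in> I"
        using r'E by meson
      moreover from this have "j = j'" using f by (auto dest: inj_onD)
      ultimately show "(p, s) \<in> r'" using S(5) r'I by blast
    qed
    show "antisym r'"
    proof (rule antisymI)
      fix p q assume pq: "(p, q) \<in> r'" "(q, p) \<in> r'"
      then obtain i j where "p = f i" "q = f j" "(i, j) \<in> r" "i \<in> I" "j \<in> I"
        using r'E by meson
      then show "p = q" using S(6) r'D pq(2) by blast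
    qed
  qed
  have cM: "cocone I r D \<phi> M \<psi>" using lim by (simp add: elementwise_limit_def)
  have sys': "inductive_system (f ` I) r' D' \<phi>'"
    unfolding inductive_system_def
  proof (intro conjI)
    show "f ` I \<noteq> {}" using S(1) by simp
    show "partial_order_on (f ` I) r'" by (rule po)
    show "\<forall>i\<in>f ` I. \<forall>j\<in>f ` I. \<exists>k\<in>f ` I. (i, k) \<in> r' \<and> (j, k) \<in> r'"
      using S(7) S(3) r'I by (metis (no_types, lifting) imageE imageI)
    show "\<forall>i\<in>f ` I. comm_monoid (D' i)"
      using D' transport_comm_monoid c S(8) by fastforce
    show "\<forall>i\<in>f ` I. \<forall>x\<in>carrier (D' i). \<phi>' i i x = x"
      using car phi' S(10) by auto
    show "\<forall>(p, q)\<in>r'. \<phi>' p q \<in> monoid_hom (D' p) (D' q)"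
    proof safe
      fix p q assume "(p, q) \<in> r'"
      then obtain i j where ij: "p = f i" "q = f j" "(i, j) \<in> r" "i \<in> I" "j \<in> I"
        using r'E by meson
      note h = monoid_homD[OF S(9)[OF ij(3)]]
      show "\<phi>' p q \<in> monoid_hom (D' p) (D' q)"
        by (rule monoid_homI) (use ij h opcl in \<open>auto simp: car one mult phi'\<close>)
    qed
    show "\<forall>p q s. (p, q) \<in> r' \<longrightarrow> (q, s) \<in> r' \<longrightarrow>
      (\<forall>x\<in>carrier (D' p). \<phi>' q s (\<phi>' p q x) = \<phi>' p s x)"
    proof (intro allI impI ballI)
      fix p q s x assume "(p, q) \<in> r'" "(q, s) \<in> r'" and x: "x \<in> carrier (D' p)"
      then obtain i j j' k where *: "p = f i" "q = f j" "q = f j'" "s = f k"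
        "(i, j) \<in> r" "(j', k) \<in> r" "i \<in> I" "j \<in> I" "j' \<in> I" "k \<in> I"
        using r'E by meson
      moreover from this have j: "j = j'" using f by (auto dest: inj_onD)
      moreover obtain y where y: "y \<in> carrier (D i)" "x = c i y" using x * car by auto
      moreover have "\<phi> i j y \<in> carrier (D j)" using cl * y by blast
      moreover have "\<phi> j k (\<phi> i j y) = \<phi> i k y" using S(11) *(5,6) j y(1) by blast
      ultimately show "\<phi>' q s (\<phi>' p q x) = \<phi>' p s x" by (simp add: phi')
    qed
  qed
  have "elementwise_limit (f ` I) r' D' \<phi>' M \<psi>'"
    unfolding elementwise_limit_def
  proof (intro conjI)
    show "cocone (f ` I) r' D' \<phi>' M \<psi>'"
      unfolding cocone_def
    proof (intro conjI)
      show "comm_monoid M" using coconeD(1)[OF cM] .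
      show "\<forall>p\<in>f ` I. \<psi>' p \<in> monoid_hom (D' p) M"
      proof safe
        fix i assume i: "i \<in> I"
        note h = monoid_homD[OF coconeD(2)[OF cM i]]
        show "\<psi>' (f i) \<in> monoid_hom (D' (f i)) M"
          by (rule monoid_homI) (use i h opcl in \<open>auto simp: car one mult psi'\<close>)
      qed
      show "\<forall>(p, q)\<in>r'. \<forall>x\<in>carrier (D' p). \<psi>' q (\<phi>' p q x) = \<psi>' p x"
      proof safe
        fix p q x assume "(p, q) \<in> r'" and x: "x \<in> carrier (D' p)"
        then obtain i j where ij: "p = f i" "q = f j" "(i, j) \<in> r" "i \<in> I" "j \<in> I"
          using r'E by meson
        then show "\<psi>' q (\<phi>' p q x) = \<psi>' p x"
          using x coconeD(3)[OF cM] cl by (auto simp: car phi' psi')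
      qed
    qed
    show "\<forall>a\<in>carrier M. \<exists>i\<in>f ` I. \<exists>x\<in>carrier (D' i). \<psi>' i x = a"
    proof
      fix a assume "a \<in> carrier M"
      then obtain i x where "i \<in> I" "x \<in> carrier (D i)" "\<psi> i x = a"
        using lim unfolding elementwise_limit_def by blast
      then show "\<exists>i\<in>f ` I. \<exists>x\<in>carrier (D' i). \<psi>' i x = a"
        using psi' car by (intro bexI[of _ "f i"] bexI[of _ "c i x"]) auto
    qed
    show "\<forall>p\<in>f ` I. \<forall>x\<in>carrier (D' p). \<forall>y\<in>carrier (D' p).
      \<psi>' p x = \<psi>' p y \<longrightarrow> (\<exists>q. (p, q) \<in> r' \<and> \<phi>' p q x = \<phi>' p q y)"
    proof (intro ballI impI)
      fix p x y assume "p \<in> f ` I" "x \<in> carrier (D' p)" "y \<in> carrier (D' p)" and e: "\<psi>' p x = \<psi>' p y"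
      then obtain i u v where *: "i \<in> I" "p = f i" "u \<in> carrier (D i)" "v \<in> carrier (D i)"
          "x = c i u" "y = c i v" by (auto simp: car)
      then have "\<psi> i u = \<psi> i v" using e psi' by simp
      then obtain j where j: "(i, j) \<in> r" "\<phi> i j u = \<phi> i j v"
        using lim * unfolding elementwise_limit_def by blast
      then have "(p, f j) \<in> r'" using r'I * by blast
      moreover have "\<phi>' p (f j) x = \<phi>' p (f j) y" using * j phi' S(3) by simp
      ultimately show "\<exists>q. (p, q) \<in> r' \<and> \<phi>' p q x = \<phi>' p q y" by blast
    qed
  qed
  moreover have "\<forall>p\<in>f ` I. \<exists>i\<in>I. D' p = transport (c i) (D i)"
    using D' by blast
  ultimately show ?thesis using sys' by blast
qed

lemma finitely_generated_countable:
  assumes "comm_monoid M" "finitely_generated_monoid M"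
  shows "countable (carrier M)"
proof -
  interpret comm_monoid M by fact
  obtain S where S: "finite S" "S \<subseteq> carrier M" "\<And>H. submonoid H M \<Longrightarrow> S \<subseteq> H \<Longrightarrow> H = carrier M"
    using assms(2) by (auto simp: finitely_generated_monoid_def)
  define ev where "ev xs = foldr (\<otimes>\<^bsub>M\<^esub>) xs \<one>\<^bsub>M\<^esub>" for xs
  have cl: "ev xs \<in> carrier M" if "set xs \<subseteq> S" for xs
    using that S(2) by (induction xs) (auto simp: ev_def)
  have app: "ev (xs @ ys) = ev xs \<otimes>\<^bsub>M\<^esub> ev ys" if "set xs \<subseteq> S" "set ys \<subseteq> S" for xs ys
    using that(1)
  proof (induction xs)
    case Nil
    then show ?case using cl[OF that(2)] by (simp add: ev_def)
  next
    case (Cons a xs)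
    then show ?case using cl[OF that(2)] cl[of xs] S(2) by (auto simp: ev_def m_assoc)
  qed
  have "submonoid (ev ` lists S) M"
  proof
    show "ev ` lists S \<subseteq> carrier M" using cl by auto
    have "ev [] = \<one>\<^bsub>M\<^esub>" by (simp add: ev_def)
    then show "\<one>\<^bsub>M\<^esub> \<in> ev ` lists S" by (metis lists.Nil imageI)
    fix x y assume "x \<in> ev ` lists S" "y \<in> ev ` lists S"
    then obtain xs ys where "x = ev xs" "y = ev ys" "set xs \<subseteq> S" "set ys \<subseteq> S" by auto
    then show "x \<otimes>\<^bsub>M\<^esub> y \<in> ev ` lists S" using app
      by (intro image_eqI[of _ _ "xs @ ys"]) auto
  qed
  moreover have "S \<subseteq> ev ` lists S"
  proof
    fix x assume "x \<in> S"
    then show "x \<in> ev ` lists S" using S(2)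
      by (intro image_eqI[of _ _ "[x]"]) (auto simp: ev_def)
  qed
  ultimately have "carrier M = ev ` lists S" using S(3) by simp
  then show ?thesis using S(1) by (simp add: countable_finite)
qed

text \<open>
  A Loewenheim-Skolem argument: terms naming the indices of a subsystem which has the same
  limit as the given system.
\<close>

datatype 'a index_term = Rep 'a | Bound "'a index_term" "'a index_term" | Wit "'a index_term" nat nat

lemma index_term_embedding: "\<exists>f :: 'a index_term \<Rightarrow> 'a list. inj f"
proof -
  have inf: "infinite (UNIV :: 'a list set)" by (rule infinite_UNIV_listI)
  obtain p :: "'a list \<times> 'a list \<Rightarrow> 'a list" where "bij_betw p (UNIV \<times> UNIV) UNIV"
    using iffD2[OF card_of_ordIso card_of_Times_same_infinite[OF inf]] by blast
  then have "inj p" by (simp add: bij_betw_def)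
  then have p: "p x = p y \<longleftrightarrow> x = y" for x y
    by (rule inj_eq)
  define num :: "nat \<Rightarrow> 'a list" where "num n = replicate n undefined" for n
  have num: "num m = num n \<longleftrightarrow> m = n" for m n
    unfolding num_def by (metis length_replicate)
  define enc :: "'a index_term \<Rightarrow> 'a list" where
    "enc = rec_index_term (\<lambda>a. p (num 0, [a])) (\<lambda>_ _ s t. p (num 1, p (s, t)))
        (\<lambda>_ m n s. p (num 2, p (s, p (num m, num n))))"
  have enc: "enc (Rep a) = p (num 0, [a])" "enc (Bound s t) = p (num 1, p (enc s, enc t))"
    "enc (Wit s m n) = p (num 2, p (enc s, p (num m, num n)))" for a s t m n
    by (simp_all add: enc_def)
  have "enc s = enc t \<Longrightarrow> s = t" for s t
  proof (induction s arbitrary: t)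
    case (Rep a)
    then show ?case by (cases t) (auto simp: enc p num)
  next
    case (Bound s1 s2)
    then show ?case by (cases t) (auto simp: enc p num)
  next
    case (Wit s m n)
    then show ?case by (cases t) (auto simp: enc p num)
  qed
  then show ?thesis by (auto simp: inj_def)
qed

theorem tame_elementwise_limit:
  fixes M :: "('a, 'n) monoid_scheme" and D :: "'i \<Rightarrow> ('b, 'm) monoid_scheme"
  assumes "refinement_monoid M"
    and sys: "inductive_system I r D \<phi>" and lim: "elementwise_limit I r D \<phi> M \<psi>"
    and fg: "\<And>i. i \<in> I \<Longrightarrow> finitely_generated_monoid (D i)"
    and ref: "\<And>i. i \<in> I \<Longrightarrow> refinement_monoid (D i)"
  shows "tame M"
proof -
  note S = inductive_systemD[OF sys]
  have cnt: "countable (carrier (D i))" if "i \<in> I" for i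
    using finitely_generated_countable S(8) fg that by blast
  define e where "e i = from_nat_into (carrier (D i))" for i
  have ne: "carrier (D i) \<noteq> {}" if "i \<in> I" for i
    using comm_monoid_closed(1)[OF S(8)[OF that]] by blast
  have e: "e i n \<in> carrier (D i)" if "i \<in> I" for i n
    unfolding e_def using from_nat_into[OF ne[OF that]] .
  have e_surj: "\<exists>n. e i n = x" if "i \<in> I" "x \<in> carrier (D i)" for i x
    unfolding e_def using from_nat_into_surj[OF cnt] that by blast
  have "\<exists>i. i \<in> I \<and> (a \<in> carrier M \<longrightarrow> (\<exists>x\<in>carrier (D i). \<psi> i x = a))" for a
    using lim S(1) unfolding elementwise_limit_def by blast
  then obtain rep where rep: "\<And>a. rep a \<in> I"
      "\<And>a. a \<in> carrier M \<Longrightarrow> \<exists>x\<in>carrier (D (rep a)). \<psi> (rep a) x = a"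
    by metis
  have "\<exists>k. i \<in> I \<longrightarrow> j \<in> I \<longrightarrow> (i, k) \<in> r \<and> (j, k) \<in> r" for i j
    using S(7) by blast
  then obtain ub where ub: "\<And>i j. i \<in> I \<Longrightarrow> j \<in> I \<Longrightarrow> (i, ub i j) \<in> r \<and> (j, ub i j) \<in> r"
    by metis
  have "\<exists>k. i \<in> I \<longrightarrow> (i, k) \<in> r \<and>
      (\<psi> i (e i m) = \<psi> i (e i n) \<longrightarrow> \<phi> i k (e i m) = \<phi> i k (e i n))" for i m n
    using lim e S(4) unfolding elementwise_limit_def by metis
  then obtain wit where wit: "\<And>i m n. i \<in> I \<Longrightarrow> (i, wit i m n) \<in> r"
      "\<And>i m n. i \<in> I \<Longrightarrow> \<psi> i (e i m) = \<psi> i (e i n) \<Longrightarrow>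
        \<phi> i (wit i m n) (e i m) = \<phi> i (wit i m n) (e i n)"
    by metis
  define ev :: "'a index_term \<Rightarrow> 'i" where
    "ev = rec_index_term rep (\<lambda>_ _ i j. ub i j) (\<lambda>_ m n i. wit i m n)"
  have ev: "ev (Rep a) = rep a" "ev (Bound s t) = ub (ev s) (ev t)" "ev (Wit s m n) = wit (ev s) m n"
    for a s t m n
    by (simp_all add: ev_def)
  have evI: "ev t \<in> I" for t
  proof (induction t)
    case (Bound s t)
    then show ?case using ub S(3) ev by metis
  next
    case (Wit s m n)
    then show ?case using wit(1) S(3) ev by metis
  qed (simp add: ev rep)
  define J where "J = range ev"
  have evJ: "rep a \<in> J" "ub (ev s) (ev t) \<in> J" "wit (ev s) m n \<in> J" for a s t m n
    unfolding J_def ev[symmetric] by (rule rangeI)+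
  have JI: "J \<subseteq> I" using evI by (auto simp: J_def)
  have dir: "\<exists>k\<in>J. (i, k) \<in> r \<and> (j, k) \<in> r" if "i \<in> J" "j \<in> J" for i j
  proof -
    obtain s t where "i = ev s" "j = ev t" using \<open>i \<in> J\<close> \<open>j \<in> J\<close> by (auto simp: J_def)
    then show ?thesis using ub[OF evI evI, of s t] evJ by blast
  qed
  have surj: "\<exists>i\<in>J. \<exists>x\<in>carrier (D i). \<psi> i x = a" if "a \<in> carrier M" for a
    using rep(2)[OF that] evJ by blast
  have idn: "\<exists>j\<in>J. (i, j) \<in> r \<and> \<phi> i j x = \<phi> i j y"
    if i: "i \<in> J" and xy: "x \<in> carrier (D i)" "y \<in> carrier (D i)" and eq: "\<psi> i x = \<psi> i y"
    for i x y
  proof -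
    obtain s where s: "i = ev s" using i by (auto simp: J_def)
    obtain m n where "x = e i m" "y = e i n"
      using e_surj[OF evI[of s]] xy unfolding s by metis
    then show ?thesis
      using wit[OF evI, of s m n] eq evJ(3)[of s m n] unfolding s by blast
  qed
  have "J \<noteq> {}" using evJ by blast
  note sub = elementwise_restrict[OF sys lim JI this dir surj idn]
  obtain enc :: "'a index_term \<Rightarrow> 'a list" where enc: "inj enc"
    using index_term_embedding by blast
  define f where "f i = enc (inv_into UNIV ev i)" for i
  have f: "inj_on f J"
  proof (rule inj_onI)
    fix i j assume ij: "i \<in> J" "j \<in> J" "f i = f j"
    then have "inv_into UNIV ev i = inv_into UNIV ev j" using enc by (simp add: f_def inj_eq)
    then show "i = j" using ij(1,2) unfolding J_def by (metis f_inv_into_f)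
  qed
  define c where "c i x = replicate (to_nat_on (carrier (D i)) x) (undefined :: 'a)" for i x
  have cinj: "inj_on (c i) (carrier (D i))" if "i \<in> J" for i
  proof (rule inj_onI)
    fix x y assume xy: "x \<in> carrier (D i)" "y \<in> carrier (D i)" "c i x = c i y"
    then have "to_nat_on (carrier (D i)) x = to_nat_on (carrier (D i)) y"
      unfolding c_def by (metis length_replicate)
    then show "x = y" using xy cnt JI that by (auto dest: inj_onD[OF inj_on_to_nat_on])
  qed
  obtain I' :: "'a list set" and r' and D' :: "'a list \<Rightarrow> 'a list monoid" and \<phi>' \<psi>' where
    *: "inductive_system I' r' D' \<phi>'" "elementwise_limit I' r' D' \<phi>' M \<psi>'"
      "\<forall>p\<in>I'. \<exists>i\<in>J. D' p = transport (c i) (D i)"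
    using elementwise_transport[OF sub f cinj] by blast
  have "finitely_generated_monoid (D' p) \<and> refinement_monoid (D' p)" if p: "p \<in> I'" for p
  proof -
    obtain i where i: "i \<in> J" "D' p = transport (c i) (D i)"
      using bspec[OF *(3) p] by blast
    have "i \<in> I" using JI i(1) by (rule subsetD)
    then show ?thesis
      unfolding i(2)
      using transport_fg[OF cinj[OF i(1)] S(8) fg] transport_refinement[OF cinj[OF i(1)] ref]
      by blast
  qed
  moreover have "inductive_limit TYPE('a list) I' r' D' \<phi>' M \<psi>'"
    using elementwise_imp_inductive_limit[OF *(1,2)] .
  ultimately show ?thesis unfolding tame_def using assms(1) *(1) by blast
qed

lemma monoid_hom_comp:
  "h \<in> monoid_hom A B \<Longrightarrow> k \<in> monoid_hom B C \<Longrightarrow> (\<lambda>x. k (h x)) \<in> monoid_hom A C"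
  by (rule monoid_homI) (auto simp: monoid_homD)

lemma cocone_comp:
  assumes "cocone I r D \<phi> M \<psi>" "comm_monoid N" "h \<in> monoid_hom M N"
  shows "cocone I r D \<phi> N (\<lambda>i x. h (\<psi> i x))"
  using coconeD(3)[OF assms(1)] assms(2) monoid_hom_comp[OF coconeD(2)[OF assms(1)] assms(3)]
  unfolding cocone_def by auto

theorem inductive_limit_imp_elementwise:
  fixes D :: "'i \<Rightarrow> ('b, 'm) monoid_scheme" and M :: "('a, 'n) monoid_scheme"
    and f :: "'i \<times> 'b \<Rightarrow> 'u" and g :: "'a \<Rightarrow> 'u"
  assumes sys: "inductive_system I r D \<phi>" and lim: "inductive_limit TYPE('u) I r D \<phi> M \<psi>"
    and f: "inj f" and g: "inj g"
  shows "elementwise_limit I r D \<phi> M \<psi>"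
proof -
  note S = inductive_systemD[OF sys]
  have cM: "cocone I r D \<phi> M \<psi>"
    and ex: "\<And>(N :: 'u monoid) \<theta>. cocone I r D \<phi> N \<theta> \<Longrightarrow>
      \<exists>u\<in>monoid_hom M N. \<forall>i\<in>I. \<forall>x\<in>carrier (D i). u (\<psi> i x) = \<theta> i x"
    and uniq: "\<And>(N :: 'u monoid) \<theta> u u' a. cocone I r D \<phi> N \<theta> \<Longrightarrow>
      u \<in> monoid_hom M N \<Longrightarrow> u' \<in> monoid_hom M N \<Longrightarrow>
      (\<And>i x. i \<in> I \<Longrightarrow> x \<in> carrier (D i) \<Longrightarrow> u (\<psi> i x) = \<theta> i x) \<Longrightarrow>
      (\<And>i x. i \<in> I \<Longrightarrow> x \<in> carrier (D i) \<Longrightarrow> u' (\<psi> i x) = \<theta> i x) \<Longrightarrow>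
      a \<in> carrier M \<Longrightarrow> u a = u' a"
    using lim unfolding inductive_limit_def by (blast, blast, metis)
  note C = coconeD[OF cM]
  interpret M: comm_monoid M by (rule C(1))
  have cl: "\<phi> i j x \<in> carrier (D j)" if "(i, j) \<in> r" "x \<in> carrier (D i)" for i j x
    using monoid_homD(1)[OF S(9)] that by blast
  have psi_cl: "\<psi> i x \<in> carrier M" if "i \<in> I" "x \<in> carrier (D i)" for i x
    using monoid_homD(1)[OF C(2)] that by blast
  obtain i0 where i0: "i0 \<in> I" using S(1) by blast

  have surj: "\<exists>i\<in>I. \<exists>x\<in>carrier (D i). \<psi> i x = a" if a: "a \<in> carrier M" for a
  proof -
    define T where "T = {\<psi> i x | i x. i \<in> I \<and> x \<in> carrier (D i)}"
    define A where "A = M\<lparr>carrier := T\<rparr>"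
    have T: "T \<subseteq> carrier M" using psi_cl by (auto simp: T_def)
    have Tone: "\<one>\<^bsub>M\<^esub> \<in> T"
      unfolding T_def using i0 comm_monoid_closed(1)[OF S(8)[OF i0]] monoid_homD(3)[OF C(2)[OF i0]]
      by force
    have Tmult: "p \<otimes>\<^bsub>M\<^esub> q \<in> T" if pq: "p \<in> T" "q \<in> T" for p q
    proof -
      obtain i x j y where ij: "i \<in> I" "x \<in> carrier (D i)" "p = \<psi> i x"
          "j \<in> I" "y \<in> carrier (D j)" "q = \<psi> j y"
        using pq unfolding T_def by blast
      obtain k where k: "(i, k) \<in> r" "(j, k) \<in> r" using S(7)[OF ij(1,4)] by blast
      have kI: "k \<in> I" using S(3)[OF k(1)] .
      have "p \<otimes>\<^bsub>M\<^esub> q = \<psi> k (\<phi> i k x) \<otimes>\<^bsub>M\<^esub> \<psi> k (\<phi> j k y)"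
        using C(3)[OF k(1) ij(2)] C(3)[OF k(2) ij(5)] ij by simp
      also have "\<dots> = \<psi> k (\<phi> i k x \<otimes>\<^bsub>D k\<^esub> \<phi> j k y)"
        using monoid_homD(2)[OF C(2)[OF kI]] cl k ij by simp
      finally show ?thesis
        unfolding T_def using kI comm_monoid_closed(2)[OF S(8)[OF kI]] cl k ij by blast
    qed
    have A: "comm_monoid A"
      unfolding A_def
      by (rule comm_monoidI) (use T Tone Tmult in \<open>auto simp: M.m_ac subset_iff\<close>)
    have cA: "cocone I r D \<phi> A \<psi>"
      unfolding cocone_def
    proof (intro conjI)
      show "\<forall>i\<in>I. \<psi> i \<in> monoid_hom (D i) A"
      proof
        fix i assume i: "i \<in> I"
        show "\<psi> i \<in> monoid_hom (D i) A"
          by (rule monoid_homI)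
            (use i monoid_homD[OF C(2)[OF i]] in \<open>auto simp: A_def T_def\<close>)
      qed
    qed (use A C(3) in auto)
    have inc: "(\<lambda>x. x) \<in> monoid_hom A M"
      by (rule monoid_homI) (use T in \<open>auto simp: A_def\<close>)
    have gA: "inj_on g (carrier A)" and gM: "inj_on g (carrier M)"
      using g by (auto intro: inj_on_subset)
    let ?N = "transport g A"
    obtain u where u: "u \<in> monoid_hom M ?N" "\<forall>i\<in>I. \<forall>x\<in>carrier (D i). u (\<psi> i x) = g (\<psi> i x)"
      using ex[OF cocone_comp[OF cA transport_comm_monoid[OF gA A] transport_hom[OF gA]]] by blast
    let ?d = "inv_into (carrier A) g"
    define u0 where "u0 x = ?d (u x)" for x
    have u0: "u0 \<in> monoid_hom M A"
      unfolding u0_def by (rule monoid_hom_comp[OF u(1) transport_inv_hom[OF gA A]])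
    have u0_psi: "u0 (\<psi> i x) = \<psi> i x" if "i \<in> I" "x \<in> carrier (D i)" for i x
    proof -
      have "\<psi> i x \<in> carrier A" using that by (auto simp: A_def T_def)
      then show ?thesis using u(2) that gA by (simp add: u0_def)
    qed
    have "g (u0 a) = g a"
    proof (rule uniq[OF cocone_comp[OF cM transport_comm_monoid[OF gM C(1)] transport_hom[OF gM]]])
      show "(\<lambda>x. g (u0 x)) \<in> monoid_hom M (transport g M)"
        by (rule monoid_hom_comp[OF monoid_hom_comp[OF u0 inc] transport_hom[OF gM]])
      show "g \<in> monoid_hom M (transport g M)" by (rule transport_hom[OF gM])
    qed (use u0_psi a in auto)
    then have "u0 a = a" using g by (simp add: inj_eq)
    moreover have "u0 a \<in> carrier A" using monoid_homD(1)[OF u0 a] .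
    ultimately show ?thesis by (auto simp: A_def T_def)
  qed

  define E where "E p q \<longleftrightarrow> (\<exists>k. (fst p, k) \<in> r \<and> (fst q, k) \<in> r \<and>
      snd p \<in> carrier (D (fst p)) \<and> snd q \<in> carrier (D (fst q)) \<and>
      \<phi> (fst p) k (snd p) = \<phi> (fst q) k (snd q))" for p q
  have up: "\<phi> i l x = \<phi> j l y"
    if "\<phi> i k x = \<phi> j k y" "(i, k) \<in> r" "(j, k) \<in> r" "(k, l) \<in> r" "x \<in> carrier (D i)" "y \<in> carrier (D j)"
    for i j k l x y
    using S(11)[OF that(2,4,5)] S(11)[OF that(3,4,6)] that(1) by simp
  have Erefl: "E (i, x) (i, x)" if "i \<in> I" "x \<in> carrier (D i)" for i x
    using that S(4) by (auto simp: E_def)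
  have Esym: "E p q \<Longrightarrow> E q p" for p q by (auto simp: E_def)
  have Etrans: "E p s" if pq: "E p q" and qs: "E q s" for p q s
  proof -
    obtain k where k: "(fst p, k) \<in> r" "(fst q, k) \<in> r" "snd p \<in> carrier (D (fst p))"
      "snd q \<in> carrier (D (fst q))" "\<phi> (fst p) k (snd p) = \<phi> (fst q) k (snd q)"
      using pq unfolding E_def by blast
    obtain l where l: "(fst q, l) \<in> r" "(fst s, l) \<in> r"
      "snd s \<in> carrier (D (fst s))" "\<phi> (fst q) l (snd q) = \<phi> (fst s) l (snd s)"
      using qs unfolding E_def by blast
    obtain m where m: "(k, m) \<in> r" "(l, m) \<in> r"
      using S(7)[OF S(3)[OF k(1)] S(3)[OF l(1)]] by blast
    have "\<phi> (fst p) m (snd p) = \<phi> (fst s) m (snd s)"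
      using up[OF k(5,1,2) m(1) k(3,4)] up[OF l(4,1,2) m(2) k(4) l(3)] by simp
    then show ?thesis
      unfolding E_def using S(5)[OF k(1) m(1)] S(5)[OF l(2) m(2)] k(3) l(3) by blast
  qed
  define can where "can p = (SOME q. E p q)" for p
  have canE: "E p (can p)" if "E p p" for p
    unfolding can_def using that by (rule someI)
  have can: "can p = can q \<longleftrightarrow> E p q" if "E p p" "E q q" for p q
  proof
    assume "can p = can q"
    then show "E p q" using canE[OF that(1)] canE[OF that(2)] Esym Etrans by metis
  next
    assume "E p q"
    then have "E p = E q" using Esym Etrans by blast
    then show "can p = can q" by (simp add: can_def)
  qed
  define U where "U = {(i, x). i \<in> I \<and> x \<in> carrier (D i)}"
  have EU: "E p p \<longleftrightarrow> p \<in> U" for p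
    using Erefl S(2) by (cases p) (auto simp: U_def E_def)
  have canU: "can p \<in> U" if "p \<in> U" for p
    using canE[of p] that Etrans Esym EU by blast
  define ub where "ub i j = (SOME k. (i, k) \<in> r \<and> (j, k) \<in> r)" for i j
  have ub: "(i, ub i j) \<in> r" "(j, ub i j) \<in> r" if "i \<in> I" "j \<in> I" for i j
    using someI_ex[OF S(7)[OF that]] unfolding ub_def by auto
  define pl where "pl p q = (let k = ub (fst p) (fst q) in
      (k, \<phi> (fst p) k (snd p) \<otimes>\<^bsub>D k\<^esub> \<phi> (fst q) k (snd q)))" for p q
  have Emult: "E (k, \<phi> i k x \<otimes>\<^bsub>D k\<^esub> \<phi> j k y) (k', \<phi> i' k' x' \<otimes>\<^bsub>D k'\<^esub> \<phi> j' k' y')"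
    if p: "E (i, x) (i', x')" "E (j, y) (j', y')"
      and k: "(i, k) \<in> r" "(j, k) \<in> r" and k': "(i', k') \<in> r" "(j', k') \<in> r"
    for i x i' x' j y j' y' k k'
  proof -
    obtain a where a: "(i, a) \<in> r" "(i', a) \<in> r" "x \<in> carrier (D i)" "x' \<in> carrier (D i')"
        "\<phi> i a x = \<phi> i' a x'" using p(1) by (auto simp: E_def)
    obtain b where b: "(j, b) \<in> r" "(j', b) \<in> r" "y \<in> carrier (D j)" "y' \<in> carrier (D j')"
        "\<phi> j b y = \<phi> j' b y'" using p(2) by (auto simp: E_def)
    obtain m1 where m1: "(a, m1) \<in> r" "(b, m1) \<in> r"
      using S(7)[OF S(3)[OF a(1)] S(3)[OF b(1)]] by blast
    obtain m2 where m2: "(k, m2) \<in> r" "(k', m2) \<in> r"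
      using S(7)[OF S(3)[OF k(1)] S(3)[OF k'(1)]] by blast
    obtain m where m: "(m1, m) \<in> r" "(m2, m) \<in> r"
      using S(7)[OF S(3)[OF m1(1)] S(3)[OF m2(1)]] by blast
    have am: "(a, m) \<in> r" "(b, m) \<in> r" "(k, m) \<in> r" "(k', m) \<in> r"
      using S(5) m1 m2 m by blast+
    have "\<phi> k m (\<phi> i k x \<otimes>\<^bsub>D k\<^esub> \<phi> j k y) = \<phi> i m x \<otimes>\<^bsub>D m\<^esub> \<phi> j m y"
      using monoid_homD(2)[OF S(9)[OF am(3)] cl[OF k(1) a(3)] cl[OF k(2) b(3)]]
        S(11)[OF k(1) am(3) a(3)] S(11)[OF k(2) am(3) b(3)] by simp
    moreover have "\<phi> k' m (\<phi> i' k' x' \<otimes>\<^bsub>D k'\<^esub> \<phi> j' k' y') = \<phi> i' m x' \<otimes>\<^bsub>D m\<^esub> \<phi> j' m y'"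
      using monoid_homD(2)[OF S(9)[OF am(4)] cl[OF k'(1) a(4)] cl[OF k'(2) b(4)]]
        S(11)[OF k'(1) am(4) a(4)] S(11)[OF k'(2) am(4) b(4)] by simp
    moreover have "\<phi> i m x = \<phi> i' m x'" "\<phi> j m y = \<phi> j' m y'"
      using up[OF a(5,1,2) am(1) a(3,4)] up[OF b(5,1,2) am(2) b(3,4)] .
    moreover have "\<phi> i k x \<otimes>\<^bsub>D k\<^esub> \<phi> j k y \<in> carrier (D k)"
      by (rule comm_monoid_closed(2)[OF S(8)[OF S(3)[OF k(1)]] cl[OF k(1) a(3)] cl[OF k(2) b(3)]])
    moreover have "\<phi> i' k' x' \<otimes>\<^bsub>D k'\<^esub> \<phi> j' k' y' \<in> carrier (D k')"
      by (rule comm_monoid_closed(2)[OF S(8)[OF S(3)[OF k'(1)]] cl[OF k'(1) a(4)] cl[OF k'(2) b(4)]])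
    ultimately show ?thesis
      unfolding E_def using am(3,4) by (intro exI[of _ m]) simp
  qed
  have plE: "E (pl (i, x) (j, y)) (k, \<phi> i' k x' \<otimes>\<^bsub>D k\<^esub> \<phi> j' k y')"
    if p: "E (i, x) (i', x')" "E (j, y) (j', y')" and k: "(i', k) \<in> r" "(j', k) \<in> r"
    for i x i' x' j y j' y' k
  proof -
    have "i \<in> I" "j \<in> I" using p S(2) by (auto simp: E_def)
    then show ?thesis unfolding pl_def Let_def using Emult[OF p ub k] by simp
  qed
  have plE2: "E (pl p q) (pl p' q')" if "E p p'" "E q q'" for p q p' q'
  proof -
    obtain i' x' j' y' where e: "p' = (i', x')" "q' = (j', y')" by fastforce
    then have "i' \<in> I" "j' \<in> I" using that S(2) by (auto simp: E_def)
    then show ?thesis using plE[of "fst p" "snd p" i' x' "fst q" "snd q" j' y'] that ub e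
      by (simp add: pl_def[of "(i', x')"] Let_def)
  qed
  have plU: "pl p q \<in> U" if "p \<in> U" "q \<in> U" for p q
    using plE2[of p p q q] that Esym Etrans EU by blast
  define L where "L = \<lparr>carrier = can ` U, monoid.mult = (\<lambda>p q. can (pl p q)), one = can (i0, \<one>\<^bsub>D i0\<^esub>)\<rparr>"
  define \<theta> where "\<theta> i x = can (i, x)" for i x
  have th_mult: "\<theta> i x \<otimes>\<^bsub>L\<^esub> \<theta> j y = \<theta> k (\<phi> i k x \<otimes>\<^bsub>D k\<^esub> \<phi> j k y)"
    if "i \<in> I" "x \<in> carrier (D i)" "j \<in> I" "y \<in> carrier (D j)" and k: "(i, k) \<in> r" "(j, k) \<in> r"
    for i x j y k
  proof -
    have U: "(i, x) \<in> U" "(j, y) \<in> U" using that by (auto simp: U_def)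
    then have "E (can (i, x)) (i, x)" "E (can (j, y)) (j, y)" using canE EU Esym by blast+
    then have "E (pl (can (i, x)) (can (j, y))) (k, \<phi> i k x \<otimes>\<^bsub>D k\<^esub> \<phi> j k y)"
      using plE[of "fst (can (i, x))" "snd (can (i, x))" i x "fst (can (j, y))" "snd (can (j, y))"] k
      by simp
    moreover from this have "(k, \<phi> i k x \<otimes>\<^bsub>D k\<^esub> \<phi> j k y) \<in> U" using EU Esym Etrans by blast
    ultimately show ?thesis
      using can plU canU U EU by (simp add: L_def \<theta>_def)
  qed
  have th_car: "\<theta> i x \<in> carrier L" if "i \<in> I" "x \<in> carrier (D i)" for i x
    using that by (auto simp: L_def \<theta>_def U_def)
  have th_surj: "\<exists>i x. i \<in> I \<and> x \<in> carrier (D i) \<and> p = \<theta> i x" if "p \<in> carrier L" for p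
    using that by (auto simp: L_def \<theta>_def U_def)
  have th_phi: "\<theta> j (\<phi> i j x) = \<theta> i x" if ij: "(i, j) \<in> r" "x \<in> carrier (D i)" for i j x
  proof -
    have I: "i \<in> I" "j \<in> I" using S(2,3) ij(1) by blast+
    have "E (j, \<phi> i j x) (i, x)"
      unfolding E_def using ij cl[OF ij] S(4)[OF I(2)] S(10)[OF I(2) cl[OF ij]]
      by (intro exI[of _ j]) simp
    then show ?thesis unfolding \<theta>_def using can EU ij cl[OF ij] I by (simp add: U_def)
  qed
  have th_eq: "\<theta> i x = \<theta> j y \<longleftrightarrow> E (i, x) (j, y)"
    if "i \<in> I" "x \<in> carrier (D i)" "j \<in> I" "y \<in> carrier (D j)" for i x j y
    unfolding \<theta>_def using that by (intro can Erefl)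
  have common: "\<exists>k y. k \<in> I \<and> y \<in> carrier (D k) \<and> p = \<theta> k y \<and> (i, k) \<in> r"
    if "i \<in> I" "p \<in> carrier L" for i p
  proof -
    obtain j x where "j \<in> I" "x \<in> carrier (D j)" "p = \<theta> j x" using th_surj \<open>p \<in> carrier L\<close> by blast
    moreover from this obtain k where "(i, k) \<in> r" "(j, k) \<in> r" using S(7) \<open>i \<in> I\<close> by blast
    ultimately show ?thesis using th_phi cl S(3) by metis
  qed
  have mult1: "\<theta> k x \<otimes>\<^bsub>L\<^esub> \<theta> k y = \<theta> k (x \<otimes>\<^bsub>D k\<^esub> y)"
    if "k \<in> I" "x \<in> carrier (D k)" "y \<in> carrier (D k)" for k x y
    using th_mult[of k x k y k] S(4,10) that by simp
  have th_one: "\<theta> i \<one>\<^bsub>D i\<^esub> = \<one>\<^bsub>L\<^esub>" if i: "i \<in> I" for i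
  proof -
    obtain k where k: "(i, k) \<in> r" "(i0, k) \<in> r" using S(7)[OF i i0] by blast
    have "\<theta> i \<one>\<^bsub>D i\<^esub> = \<theta> k \<one>\<^bsub>D k\<^esub>" "\<theta> i0 \<one>\<^bsub>D i0\<^esub> = \<theta> k \<one>\<^bsub>D k\<^esub>"
      using th_phi[OF k(1)] th_phi[OF k(2)] comm_monoid_closed(1) S(8) i i0
        monoid_homD(3)[OF S(9)[OF k(1)]] monoid_homD(3)[OF S(9)[OF k(2)]] by metis+
    then show ?thesis by (simp add: L_def \<theta>_def)
  qed
  have three: "\<exists>k x y z. k \<in> I \<and> x \<in> carrier (D k) \<and> y \<in> carrier (D k) \<and> z \<in> carrier (D k) \<and>
      p = \<theta> k x \<and> q = \<theta> k y \<and> s = \<theta> k z" if pqs: "p \<in> carrier L" "q \<in> carrier L" "s \<in> carrier L" for p q s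
  proof -
    obtain i x where 1: "i \<in> I" "x \<in> carrier (D i)" "p = \<theta> i x" using th_surj[OF pqs(1)] by blast
    obtain j y where 2: "j \<in> I" "y \<in> carrier (D j)" "q = \<theta> j y" "(i, j) \<in> r"
      using common[OF 1(1) pqs(2)] by blast
    obtain k z where 3: "k \<in> I" "z \<in> carrier (D k)" "s = \<theta> k z" "(j, k) \<in> r"
      using common[OF 2(1) pqs(3)] by blast
    have ik: "(i, k) \<in> r" using S(5)[OF 2(4) 3(4)] .
    show ?thesis
      using 3 th_phi[OF ik 1(2)] th_phi[OF 3(4) 2(2)] cl[OF ik 1(2)] cl[OF 3(4) 2(2)] 1(3) 2(3)
      by (intro exI[of _ k] exI[of _ "\<phi> i k x"] exI[of _ "\<phi> j k y"] exI[of _ z]) simp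
  qed
  have L: "comm_monoid L"
  proof (rule comm_monoidI)
    show "\<one>\<^bsub>L\<^esub> \<in> carrier L"
      using th_one[OF i0] th_car[OF i0 comm_monoid_closed(1)[OF S(8)[OF i0]]] by simp
  next
    fix p q assume "p \<in> carrier L" "q \<in> carrier L"
    then obtain k x y where k: "k \<in> I" "x \<in> carrier (D k)" "y \<in> carrier (D k)" "p = \<theta> k x" "q = \<theta> k y"
      using three by meson
    interpret K: comm_monoid "D k" using S(8)[OF k(1)] .
    show "p \<otimes>\<^bsub>L\<^esub> q \<in> carrier L" using k mult1 th_car by simp
    show "p \<otimes>\<^bsub>L\<^esub> q = q \<otimes>\<^bsub>L\<^esub> p" using k mult1 K.m_comm by simp
  next
    fix p q s assume "p \<in> carrier L" "q \<in> carrier L" "s \<in> carrier L"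
    then obtain k x y z where k: "k \<in> I" "x \<in> carrier (D k)" "y \<in> carrier (D k)" "z \<in> carrier (D k)"
        "p = \<theta> k x" "q = \<theta> k y" "s = \<theta> k z"
      using three by meson
    interpret K: comm_monoid "D k" using S(8)[OF k(1)] .
    show "p \<otimes>\<^bsub>L\<^esub> q \<otimes>\<^bsub>L\<^esub> s = p \<otimes>\<^bsub>L\<^esub> (q \<otimes>\<^bsub>L\<^esub> s)" using k mult1 K.m_assoc by simp
  next
    fix p assume "p \<in> carrier L"
    then obtain k x where k: "k \<in> I" "x \<in> carrier (D k)" "p = \<theta> k x"
      using th_surj by meson
    interpret K: comm_monoid "D k" using S(8)[OF k(1)] .
    show "\<one>\<^bsub>L\<^esub> \<otimes>\<^bsub>L\<^esub> p = p" using k mult1[OF k(1) K.one_closed k(2)] th_one[OF k(1)] by simp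
  qed
  have cL: "cocone I r D \<phi> L \<theta>"
    unfolding cocone_def using L th_phi th_car mult1 th_one by (auto intro!: monoid_homI)
  have fL: "inj_on f (carrier L)" using f by (auto intro: inj_on_subset)
  obtain u where u: "\<forall>i\<in>I. \<forall>x\<in>carrier (D i). u (\<psi> i x) = f (\<theta> i x)"
    using ex[OF cocone_comp[OF cL transport_comm_monoid[OF fL L] transport_hom[OF fL]]] by blast
  have "\<exists>j. (i, j) \<in> r \<and> \<phi> i j x = \<phi> i j y"
    if i: "i \<in> I" "x \<in> carrier (D i)" "y \<in> carrier (D i)" "\<psi> i x = \<psi> i y" for i x y
  proof -
    have "f (\<theta> i x) = f (\<theta> i y)" using u i by metis
    then have "E (i, x) (i, y)" using f th_eq i by (simp add: inj_eq)
    then show ?thesis by (auto simp: E_def)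
  qed
  then show ?thesis unfolding elementwise_limit_def using cM surj by blast
qed

text \<open>
  To prove tameness, any inductive system may be used, with the universal property tested in
  any type \<open>'u\<close> large enough to contain the disjoint union of the system and the limit.
\<close>

theorem tame_inductive_limit:
  fixes D :: "'i \<Rightarrow> ('b, 'm) monoid_scheme" and M :: "('a, 'n) monoid_scheme"
    and f :: "'i \<times> 'b \<Rightarrow> 'u" and g :: "'a \<Rightarrow> 'u"
  assumes "refinement_monoid M" "inductive_system I r D \<phi>"
    and "inductive_limit TYPE('u) I r D \<phi> M \<psi>" "inj f" "inj g"
    and "\<And>i. i \<in> I \<Longrightarrow> finitely_generated_monoid (D i)" "\<And>i. i \<in> I \<Longrightarrow> refinement_monoid (D i)"
  shows "tame M"
  using tame_elementwise_limit[OF assms(1,2) inductive_limit_imp_elementwise[OF assms(2-5)] assms(6,7)] .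

theorem tame_obtain_elementwise_limit:
  fixes M :: "('a, 'n) monoid_scheme"
  assumes "tame M"
  obtains I r and D :: "'a list \<Rightarrow> 'a list monoid" and \<phi> \<psi>
  where "inductive_system I r D \<phi>" "elementwise_limit I r D \<phi> M \<psi>"
    "\<And>i. i \<in> I \<Longrightarrow> finitely_generated_monoid (D i)" "\<And>i. i \<in> I \<Longrightarrow> refinement_monoid (D i)"
proof -
  have inf: "infinite (UNIV :: 'a list set)" by (rule infinite_UNIV_listI)
  obtain p :: "'a list \<times> 'a list \<Rightarrow> 'a list" where "bij_betw p (UNIV \<times> UNIV) UNIV"
    using iffD2[OF card_of_ordIso card_of_Times_same_infinite[OF inf]] by blast
  then have p: "inj p" by (simp add: bij_betw_def)
  have g: "inj (\<lambda>a :: 'a. [a])" by (simp add: inj_def)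
  obtain I r and D :: "'a list \<Rightarrow> 'a list monoid" and \<phi> \<psi> where
    *: "inductive_system I r D \<phi>" "inductive_limit TYPE('a list) I r D \<phi> M \<psi>"
      "\<forall>i\<in>I. finitely_generated_monoid (D i) \<and> refinement_monoid (D i)"
    using assms unfolding tame_def by blast
  show ?thesis
    by (rule that[OF *(1) inductive_limit_imp_elementwise[OF *(1,2) p g]]) (use *(3) in auto)
qed

end

theory Submission
  imports Defs "HOL-Library.Confluence"
begin

text \<open>
  Reading the defining relations of the graph monoid from left to right gives a rewriting system on
  finite sums of generators in which every rule rewrites a single generator. It is confluent: a
  vertex emitting finitely many arrows has one rule, and for an infinite emitter the rules for two
  finite sets \<open>Z\<close> and \<open>W\<close> of arrows are joined by the one for \<open>Z \<union> W\<close>. So two sums are equal in the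
  graph monoid iff they have a common reduct (\<open>congruent_iff_joinable\<close>). As a reduct of a sum is a
  sum of reducts, refinement is inherited from the free commutative monoid, where it is clear
  (\<open>refinement_presented_monoid\<close>). The monoid is conical since no rule produces the empty sum.

  The same argument applies to the presentation restricted to a set of generators that is closed
  under the operations needed for confluence (\<open>context_free_closed_generators\<close>). Every finite set of
  generators lies in a finite closed one, and the derivation of an equation involves finitely many
  generators; hence the graph monoid is the directed limit of the finitely generated refinement
  monoids presented by the finite closed sets (\<open>tame_presented_monoid\<close>).

  Unperforation and separativity are passed on by directed limits, so it suffices to prove them for a
  finitely generated refinement monoid. There every element is a sum of primes, up to a unit
  (\<open>finitely_generated_imp_primely_generated\<close>). Multiples of a prime are distributed over the
  summands of any upper bound (\<open>prime_pow_divides_mult\<close>), and a prime absorbs whatever prime lies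
  strictly below it, so that the algebraic ordering is determined by counting primes, which yields
  unperforation; and a prime \<open>p\<close> can be cancelled from \<open>p + a = p + b\<close> if it lies below \<open>a\<close> and
  \<open>b\<close> (\<open>prime_cancel\<close>), which yields separativity.
\<close>

section \<open>Prime decompositions in refinement monoids\<close>

locale refinement_comm_monoid = comm_monoid G for G (structure) +
  assumes is_refinement: "refinement_monoid G"

lemma refinement_comm_monoidI: "refinement_monoid M \<Longrightarrow> refinement_comm_monoid M"
  by (simp add: refinement_comm_monoid_def refinement_comm_monoid_axioms_def refinement_monoid_def)

context comm_monoid
begin

definition lprod :: "'a list \<Rightarrow> 'a"
  where "lprod xs = foldr (\<otimes>) xs \<one>"

lemma lprod_simps [simp]: "lprod [] = \<one>" "lprod (x # xs) = x \<otimes> lprod xs"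
  by (simp_all add: lprod_def)

lemma lprod_closed [simp]: "set xs \<subseteq> carrier G \<Longrightarrow> lprod xs \<in> carrier G"
  by (induction xs) auto

lemma lprod_append:
  "set xs \<subseteq> carrier G \<Longrightarrow> set ys \<subseteq> carrier G \<Longrightarrow> lprod (xs @ ys) = lprod xs \<otimes> lprod ys"
  by (induction xs) (simp_all add: m_assoc)

lemma lprod_split:
  assumes "set (xs @ q # ys) \<subseteq> carrier G"
  shows "lprod (xs @ q # ys) = q \<otimes> lprod (xs @ ys)"
  using assms by (simp add: lprod_append m_lcomm)

lemma divides_mult_mono:
  assumes "a divides b" "c divides d" "a \<in> carrier G" "c \<in> carrier G"
  shows "a \<otimes> c divides b \<otimes> d"
proof -
  obtain s t where st: "b = a \<otimes> s" "s \<in> carrier G" "d = c \<otimes> t" "t \<in> carrier G"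
    using assms(1,2) by (meson dividesE)
  have "b \<otimes> d = (a \<otimes> c) \<otimes> (s \<otimes> t)" using st assms(3,4) by (simp add: m_ac)
  then show ?thesis using st by (intro dividesI) auto
qed

lemma divides_pow_mono:
  assumes "a divides b" "a \<in> carrier G"
  shows "a [^] (m::nat) divides b [^] m"
  using assms by (induction m) (auto intro: divides_mult_mono)

lemma pow_divides_pow:
  assumes "a \<in> carrier G" "(i::nat) \<le> k"
  shows "a [^] i divides a [^] k"
proof
  show "a [^] k = a [^] i \<otimes> a [^] (k - i)" using assms by (simp add: nat_pow_mult)
qed (use assms in simp)

lemma prime_pow_not_divides_one:
  assumes "prime G p" "p \<in> carrier G" "0 < (n::nat)"
  shows "\<not> p [^] n divides \<one>"
proof
  assume n: "p [^] n divides \<one>"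
  have "p [^] (1::nat) divides p [^] n" using assms by (intro pow_divides_pow) auto
  then have "p divides \<one>" using divides_trans[OF _ n] assms(2) by simp
  then show False using assms Unit_eq_dividesone by (simp add: prime_def)
qed

text \<open>
  An element \<open>p\<close> is absorbed by \<open>q\<close> if \<open>p + q \<le> q\<close>. In presence of an absorbing summand, \<open>p\<close> can
  be added without any effect on the algebraic ordering.
\<close>

lemma absorb_lprod:
  assumes "set qs \<subseteq> carrier G" "p \<in> carrier G" "q \<in> set qs" "p \<otimes> q divides q"
  shows "p \<otimes> lprod qs divides lprod qs"
proof -
  obtain xs ys where qs: "qs = xs @ q # ys" using assms(3) by (meson split_list)
  have c: "q \<in> carrier G" "lprod (xs @ ys) \<in> carrier G" using assms(1) by (auto simp: qs)
  have "p \<otimes> lprod qs = (p \<otimes> q) \<otimes> lprod (xs @ ys)"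
    using lprod_split[of xs q ys] assms(1,2) c by (simp add: qs m_assoc)
  moreover have "lprod qs = q \<otimes> lprod (xs @ ys)" using lprod_split[of xs q ys] assms(1) qs by simp
  ultimately show ?thesis using divides_mult_rI[OF assms(4)] c assms(2) by simp
qed

text \<open>
  If \<open>q = p + s\<close> is prime and \<open>q \<le> p\<close> fails, then \<open>q \<le> s\<close>, so \<open>q\<close> contains \<open>p + q\<close>. Hence
  two comparable primes are either equivalent or the larger one absorbs the smaller one.
\<close>

lemma prime_absorbs_proper_divisor:
  assumes "prime G q" "p \<in> carrier G" "q \<in> carrier G" "p divides q" "\<not> q divides p"
  shows "p \<otimes> q divides q"
proof -
  obtain s where s: "q = p \<otimes> s" "s \<in> carrier G" using assms(4) by blast
  then have "q divides p \<otimes> s" using assms(3) by simp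
  then have "q divides s" using assms s(2) by (auto elim: primeE)
  then show ?thesis using s assms by (metis divides_mult_lI)
qed

text \<open>
  To bound the sum of \<open>xs\<close> by the sum of \<open>ys\<close>, each member of \<open>xs\<close> is either dropped, because it
  is absorbed, or matched with an equivalent member of \<open>ys\<close>. The list \<open>zs\<close> makes the induction
  work: it collects the members of \<open>ys\<close> that have been used for matching, which must stay
  available as absorbing elements.
\<close>

lemma lprod_divides_lprod:
  assumes "set xs \<subseteq> carrier G" "set ys \<subseteq> carrier G" "set zs \<subseteq> carrier G"
    and "\<And>p. p \<in> set xs \<Longrightarrow> (\<exists>q\<in>set ys \<union> set zs. p \<otimes> q divides q) \<or>
      length (filter (\<lambda>q. p \<sim> q) xs) \<le> length (filter (\<lambda>q. p \<sim> q) ys)"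
  shows "lprod xs \<otimes> lprod zs divides lprod ys \<otimes> lprod zs"
  using assms
proof (induction xs arbitrary: ys zs)
  case Nil
  then show ?case by (intro dividesI[of "lprod ys"]) (simp_all add: m_comm)
next
  case (Cons p xs)
  have c: "p \<in> carrier G" "lprod xs \<in> carrier G" "lprod ys \<in> carrier G" "lprod zs \<in> carrier G"
    using Cons.prems(1-3) by auto
  show ?case
  proof (cases "\<exists>q\<in>set ys \<union> set zs. p \<otimes> q divides q")
    case True
    then obtain q where "q \<in> set (ys @ zs)" "p \<otimes> q divides q" by auto
    then have "p \<otimes> lprod (ys @ zs) divides lprod (ys @ zs)"
      using Cons.prems(2,3) c by (intro absorb_lprod[of _ p q]) auto
    then have 1: "p \<otimes> (lprod ys \<otimes> lprod zs) divides lprod ys \<otimes> lprod zs"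
      using Cons.prems(2,3) by (simp add: lprod_append)
    have "lprod xs \<otimes> lprod zs divides lprod ys \<otimes> lprod zs"
    proof (rule Cons.IH)
      fix p' assume "p' \<in> set xs"
      then show "(\<exists>q\<in>set ys \<union> set zs. p' \<otimes> q divides q) \<or>
        length (filter (\<lambda>q. p' \<sim> q) xs) \<le> length (filter (\<lambda>q. p' \<sim> q) ys)"
        using Cons.prems(4)[of p'] by (auto split: if_splits)
    qed (use Cons.prems(1-3) in auto)
    then have "p \<otimes> (lprod xs \<otimes> lprod zs) divides p \<otimes> (lprod ys \<otimes> lprod zs)"
      using c by (intro divides_mult_lI) auto
    then show ?thesis using divides_trans[OF _ 1] c by (simp add: m_assoc)
  next
    case False
    then have "length (filter (\<lambda>q. p \<sim> q) (p # xs)) \<le> length (filter (\<lambda>q. p \<sim> q) ys)"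
      using Cons.prems(4)[of p] by auto
    then have "filter (\<lambda>q. p \<sim> q) ys \<noteq> []" using c(1) by auto
    then obtain q where q: "q \<in> set ys" "p \<sim> q" by (auto simp: filter_empty_conv)
    then obtain l r where ys: "ys = l @ q # r" by (meson split_list)
    have cq: "q \<in> carrier G" "lprod (l @ r) \<in> carrier G" using Cons.prems(2) by (auto simp: ys)
    have "lprod xs \<otimes> lprod (q # zs) divides lprod (l @ r) \<otimes> lprod (q # zs)"
    proof (rule Cons.IH)
      fix p' assume p': "p' \<in> set xs"
      have "p' \<sim> p \<longleftrightarrow> p' \<sim> q"
        using q(2) p' c(1) cq(1) Cons.prems(1) by (metis associated_sym associated_trans set_subset_Cons subsetD)
      then show "(\<exists>q\<in>set (l @ r) \<union> set (q # zs). p' \<otimes> q divides q) \<or>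
        length (filter (\<lambda>q. p' \<sim> q) xs) \<le> length (filter (\<lambda>q. p' \<sim> q) (l @ r))"
        using Cons.prems(4)[of p'] p' by (auto simp: ys split: if_splits)
    qed (use Cons.prems(1-3) in \<open>auto simp: ys\<close>)
    then have "q \<otimes> (lprod xs \<otimes> lprod zs) divides lprod ys \<otimes> lprod zs"
      using Cons.prems(2) lprod_split[of l q r] c cq unfolding ys by (simp add: m_ac)
    moreover have "p \<otimes> (lprod xs \<otimes> lprod zs) divides q \<otimes> (lprod xs \<otimes> lprod zs)"
      using q(2) c cq by (intro divides_mult_rI) (auto simp: associated_def)
    ultimately show ?thesis using c divides_trans by (simp add: m_assoc)
  qed
qed

lemma pow_count_divides_lprod:
  assumes "set xs \<subseteq> carrier G" "p \<in> carrier G"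
  shows "p [^] length (filter (\<lambda>q. p \<sim> q) xs) divides lprod xs"
  using assms(1)
proof (induction xs)
  case Nil
  then show ?case by simp
next
  case (Cons q xs)
  then have c: "q \<in> carrier G" "lprod xs \<in> carrier G" by auto
  let ?n = "length (filter (\<lambda>q. p \<sim> q) xs)"
  have IH: "p [^] ?n divides lprod xs" using Cons by simp
  show ?case
  proof (cases "p \<sim> q")
    case True
    then have "p [^] ?n \<otimes> p divides lprod xs \<otimes> q"
      using IH assms(2) by (intro divides_mult_mono) (auto simp: associated_def)
    then show ?thesis using True c by (simp add: m_comm)
  next
    case False
    then show ?thesis using IH assms(2) c by (simp add: divides_prod_l)
  qed
qed

end

context refinement_comm_monoid
begin

lemma refine:
  assumes "x1 \<otimes> x2 = y1 \<otimes> y2"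
    and "x1 \<in> carrier G" "x2 \<in> carrier G" "y1 \<in> carrier G" "y2 \<in> carrier G"
  obtains z11 z12 z21 z22 where "z11 \<in> carrier G" "z12 \<in> carrier G" "z21 \<in> carrier G" "z22 \<in> carrier G"
    "x1 = z11 \<otimes> z12" "x2 = z21 \<otimes> z22" "y1 = z11 \<otimes> z21" "y2 = z12 \<otimes> z22"
  using is_refinement assms unfolding refinement_monoid_def by blast

lemma riesz_decomposition:
  assumes "x divides a \<otimes> b" "x \<in> carrier G" "a \<in> carrier G" "b \<in> carrier G"
  obtains x1 x2 where "x1 \<in> carrier G" "x2 \<in> carrier G" "x = x1 \<otimes> x2" "x1 divides a" "x2 divides b"
proof -
  obtain c where c: "x \<otimes> c = a \<otimes> b" "c \<in> carrier G" using assms(1) by force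
  obtain z11 z12 z21 z22 where z: "z11 \<in> carrier G" "z12 \<in> carrier G" "z21 \<in> carrier G"
      "z22 \<in> carrier G" "x = z11 \<otimes> z12" "c = z21 \<otimes> z22" "a = z11 \<otimes> z21" "b = z12 \<otimes> z22"
    by (rule refine[OF c(1) assms(2) c(2) assms(3,4)])
  show ?thesis by (rule that[OF z(1,2,5)]) (use z in auto)
qed

text \<open>
  By refinement, a decomposition of \<open>n p + p\<close> comes from decompositions of \<open>n p\<close> and of \<open>p\<close>, and a
  prime \<open>p\<close> lies below one of the two parts of any decomposition of itself. So multiples of a
  prime are distributed over the summands of an upper bound; this makes the number of copies of
  \<open>p\<close> below an element additive.
\<close>

lemma prime_pow_divides_mult:
  assumes "prime G p" "p \<in> carrier G" "p [^] (n::nat) divides a \<otimes> b" "a \<in> carrier G" "b \<in> carrier G"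
  shows "\<exists>i j. i + j = n \<and> p [^] i divides a \<and> p [^] j divides b"
  using assms(3-5)
proof (induction n arbitrary: a b)
  case 0
  then show ?case by (auto intro: unit_divides)
next
  case (Suc n)
  obtain x y where xy: "x \<in> carrier G" "y \<in> carrier G" "p [^] n \<otimes> p = x \<otimes> y" "x divides a" "y divides b"
    using riesz_decomposition[of "p [^] Suc n" a b] Suc.prems assms(2) by auto
  obtain x1 y1 x2 y2 where z: "x1 \<in> carrier G" "y1 \<in> carrier G" "x2 \<in> carrier G" "y2 \<in> carrier G"
      "p [^] n = x1 \<otimes> y1" "p = x2 \<otimes> y2" "x = x1 \<otimes> x2" "y = y1 \<otimes> y2"
    using refine[OF xy(3) nat_pow_closed[OF assms(2)] assms(2) xy(1,2)] by blast
  have "p [^] n divides x1 \<otimes> y1" using z(1,2,5) by simp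
  then obtain i j where ij: "i + j = n" "p [^] i divides x1" "p [^] j divides y1"
    using Suc.IH z by blast
  have "p divides x2 \<otimes> y2" using z(6) assms(2) by (metis divides_refl)
  then consider "p divides x2" | "p divides y2" using assms(1) z(3,4) unfolding prime_def by blast
  then show ?case
  proof cases
    case 1
    then have "p [^] Suc i divides x" "p [^] j divides y"
      using ij z assms(2) by (auto intro: divides_mult_mono divides_prod_r)
    then show ?thesis using ij(1) xy assms(2)
      by (intro exI[of _ "Suc i"] exI[of _ j]) (auto intro: divides_trans simp del: nat_pow_Suc)
  next
    case 2
    then have "p [^] i divides x" "p [^] Suc j divides y"
      using ij z assms(2) by (auto intro: divides_mult_mono divides_prod_r)
    then show ?thesis using ij(1) xy assms(2)
      by (intro exI[of _ i] exI[of _ "Suc j"]) (auto intro: divides_trans simp del: nat_pow_Suc)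
  qed
qed

text \<open>The pigeonhole principle: if no summand \<open>y\<close> takes more than \<open>n\<close> copies, then \<open>m y\<close> takes at most \<open>m n\<close>.\<close>

lemma prime_pow_divides_pow:
  assumes "prime G p" "p \<in> carrier G" "y \<in> carrier G"
    and "p [^] (k::nat) divides y [^] (m::nat)" "m * n < k"
  shows "p [^] Suc n divides y"
  using assms(4,5)
proof (induction m arbitrary: k)
  case 0
  then show ?case using prime_pow_not_divides_one[OF assms(1,2), of k] by simp
next
  case (Suc m)
  then obtain i j where ij: "i + j = k" "p [^] i divides y [^] m" "p [^] j divides y"
    using prime_pow_divides_mult[OF assms(1,2), of k "y [^] m" y] assms(3) by auto
  show ?case
  proof (cases "Suc n \<le> j")
    case True
    then show ?thesis using ij pow_divides_pow[OF assms(2) True] assms(2) by (meson divides_trans nat_pow_closed)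
  next
    case False
    then have "m * n < i" using ij(1) Suc.prems(2) by auto
    then show ?thesis using Suc.IH ij(2) by blast
  qed
qed

text \<open>
  When \<open>n\<close> copies of \<open>p\<close> are distributed over fewer than \<open>n\<close> equivalent primes, some prime \<open>q\<close> of the
  sum either gets a copy without being equivalent to \<open>p\<close>, or gets two copies of \<open>p\<close>. In both
  cases \<open>q\<close> absorbs \<open>p\<close>.
\<close>

lemma prime_pow_divides_lprod:
  assumes "prime G p" "p \<in> carrier G" "\<forall>q\<in>set ys. prime G q" "set ys \<subseteq> carrier G"
    and "p [^] (n::nat) divides lprod ys" "length (filter (\<lambda>q. p \<sim> q) ys) < n"
  shows "\<exists>q\<in>set ys. p \<otimes> q divides q"
  using assms(3-6)
proof (induction ys arbitrary: n)
  case Nil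
  then show ?case using prime_pow_not_divides_one[OF assms(1,2), of n] by simp
next
  case (Cons q ys)
  then have c: "q \<in> carrier G" "lprod ys \<in> carrier G" "prime G q" by auto
  obtain i j where ij: "i + j = n" "p [^] i divides q" "p [^] j divides lprod ys"
    using prime_pow_divides_mult[OF assms(1,2), of n q "lprod ys"] c Cons.prems by auto
  show ?case
  proof (cases "length (filter (\<lambda>q. p \<sim> q) ys) < j")
    case True
    then show ?thesis using Cons ij by auto
  next
    case False
    have "p \<otimes> q divides q"
    proof (cases "p \<sim> q")
      case True
      then have "2 \<le> i" using False ij(1) Cons.prems(4) by auto
      then have "p [^] (2::nat) divides q"
        using pow_divides_pow[OF assms(2)] ij(2) divides_trans assms(2) by (meson nat_pow_closed)
      moreover have "p \<otimes> q divides p \<otimes> p"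
        using True assms(2) c by (intro divides_mult_lI) (auto simp: associated_def)
      ultimately show ?thesis using assms(2) c divides_trans
        by (metis m_closed numeral_2_eq_2 nat_pow_Suc nat_pow_0 l_one)
    next
      case np: False
      then have "1 \<le> i" using False ij(1) Cons.prems(4) by auto
      then have "p [^] (1::nat) divides q"
        using pow_divides_pow[OF assms(2)] ij(2) divides_trans assms(2) by (meson nat_pow_closed)
      then have "p divides q" using assms(2) by simp
      then show ?thesis
        using np prime_absorbs_proper_divisor[OF c(3) assms(2) c(1)] by (auto simp: associated_def)
    qed
    then show ?thesis by simp
  qed
qed

text \<open>
  Separative cancellation of a prime. Refining \<open>p + a = p + b\<close> gives \<open>p = p1 + p2 = p1 + a1\<close>,
  \<open>a = a1 + a2\<close> and \<open>b = p2 + a2\<close>, so \<open>p + a1 = p1 + p2 + a1 = p + p2\<close>. This finishes the proof if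
  \<open>a2\<close> contains \<open>p\<close>. Otherwise primeness puts \<open>p\<close> below both \<open>a1\<close> and \<open>p2\<close>, and then
  already \<open>a1 = p2\<close>.
\<close>

lemma prime_cancel:
  assumes "prime G p" "p \<in> carrier G" "a \<in> carrier G" "b \<in> carrier G"
    and "p \<otimes> a = p \<otimes> b" "p divides a" "p divides b"
  shows "a = b"
proof -
  obtain p1 p2 a1 a2 where z: "p1 \<in> carrier G" "p2 \<in> carrier G" "a1 \<in> carrier G" "a2 \<in> carrier G"
    and e: "p = p1 \<otimes> p2" "a = a1 \<otimes> a2" "p = p1 \<otimes> a1" "b = p2 \<otimes> a2"
    using refine[OF assms(5,2,3,2,4)] by blast
  have eq: "p \<otimes> a1 = p \<otimes> p2"
  proof -
    have "p \<otimes> a1 = (p1 \<otimes> a1) \<otimes> p2" unfolding e(1) using z by (simp add: m_ac)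
    then show ?thesis using e(3) by simp
  qed
  consider "p divides a2" | "p divides a1" "p divides p2"
    using assms(1,6,7) z e(2,4) unfolding prime_def by blast
  then show ?thesis
  proof cases
    case 1
    then obtain s where s: "a2 = p \<otimes> s" "s \<in> carrier G" by blast
    have "a = (p \<otimes> a1) \<otimes> s" "b = (p \<otimes> p2) \<otimes> s"
      using e(2,4) s z assms(2) by (simp_all add: m_ac)
    then show ?thesis using eq by simp
  next
    case 2
    then obtain s t where st: "a1 = p \<otimes> s" "s \<in> carrier G" "p2 = p \<otimes> t" "t \<in> carrier G" by blast
    have "p \<otimes> s = (p1 \<otimes> (p \<otimes> t)) \<otimes> s" using e(1) st(3) by simp
    also have "\<dots> = (p1 \<otimes> (p \<otimes> s)) \<otimes> t" using z(1) st(2,4) assms(2) by (simp add: m_ac)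
    also have "\<dots> = p \<otimes> t" using e(3) st(1) by simp
    finally have "a1 = p2" using st(1,3) by simp
    then show ?thesis using e(2,4) by simp
  qed
qed

lemma lprod_cancel:
  assumes "\<forall>p\<in>set ps. p \<in> carrier G \<and> prime G p \<and> p divides a \<and> p divides b"
    and "a \<in> carrier G" "b \<in> carrier G" "a \<otimes> lprod ps = b \<otimes> lprod ps"
  shows "a = b"
  using assms(1,4)
proof (induction ps)
  case Nil
  then show ?case using assms by simp
next
  case (Cons p ps)
  then have "p \<in> carrier G" "set ps \<subseteq> carrier G" by auto
  then have c: "p \<in> carrier G" "lprod ps \<in> carrier G" by auto
  have "a \<otimes> lprod ps = b \<otimes> lprod ps"
  proof (rule prime_cancel[of p])
    show "p \<otimes> (a \<otimes> lprod ps) = p \<otimes> (b \<otimes> lprod ps)"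
      using Cons.prems(2) c assms(2,3) by (simp add: m_ac)
  qed (use Cons.prems c assms(2,3) in \<open>auto intro: divides_prod_r\<close>)
  then show ?case using Cons by simp
qed

text \<open>
  Decompositions are only required up to association, so that a unit, being associated with the empty
  sum, has one as well.
\<close>

definition primely_generated :: bool
  where "primely_generated \<longleftrightarrow> (\<forall>x\<in>carrier G.
    \<exists>ps. set ps \<subseteq> carrier G \<and> (\<forall>p\<in>set ps. prime G p) \<and> x \<sim> lprod ps)"

text \<open>
  A generator \<open>s\<close> which is neither prime nor a unit satisfies \<open>s \<le> a + b\<close> without lying below
  \<open>a\<close> or \<open>b\<close>. Riesz decomposition writes it as \<open>s = x + y\<close> with \<open>x \<le> a\<close> and \<open>y \<le> b\<close>, and all
  generators occurring in \<open>x\<close> or \<open>y\<close> are strictly below \<open>s\<close>. As there are finitely many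
  generators, induction applies.
\<close>

lemma finitely_generated_imp_primely_generated:
  assumes "finitely_generated_monoid G"
  shows primely_generated
proof -
  define P where "P x \<longleftrightarrow> (\<exists>ps. set ps \<subseteq> carrier G \<and> (\<forall>p\<in>set ps. prime G p) \<and> x \<sim> lprod ps)" for x
  obtain S where S: "finite S" "S \<subseteq> carrier G" "\<And>H. submonoid H G \<Longrightarrow> S \<subseteq> H \<Longrightarrow> H = carrier G"
    using assms by (auto simp: finitely_generated_monoid_def)
  have P_unit: "P x" if "x \<in> Units G" for x
    unfolding P_def using that
    by (intro exI[of _ "[]"]) (auto simp: associated_def unit_divides Unit_eq_dividesone[symmetric])
  have P_mult: "P (x \<otimes> y)" if xy: "P x" "P y" "x \<in> carrier G" "y \<in> carrier G" for x y
  proof -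
    obtain ps qs where *: "set ps \<subseteq> carrier G" "\<forall>p\<in>set ps. prime G p" "x \<sim> lprod ps"
        "set qs \<subseteq> carrier G" "\<forall>p\<in>set qs. prime G p" "y \<sim> lprod qs"
      using xy(1,2) by (auto simp: P_def)
    have "x \<otimes> y \<sim> lprod (ps @ qs)"
      using * xy(3,4) by (auto simp: lprod_append associated_def intro!: divides_mult_mono)
    then show ?thesis unfolding P_def using * by (intro exI[of _ "ps @ qs"]) auto
  qed
  \<comment> \<open>An element is a sum of generators that lie below it.\<close>
  have P_divisors: "P y" if y: "y \<in> carrier G" "\<And>s. s \<in> S \<Longrightarrow> s divides y \<Longrightarrow> P s" for y
  proof -
    define H where "H = {y \<in> carrier G. (\<forall>s\<in>S. s divides y \<longrightarrow> P s) \<longrightarrow> P y}"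
    have "submonoid H G"
    proof
      show "H \<subseteq> carrier G" by (auto simp: H_def)
      show "\<one> \<in> H" using P_unit by (simp add: H_def)
      fix x y assume "x \<in> H" "y \<in> H"
      then have xy: "x \<in> carrier G" "y \<in> carrier G"
        and P: "\<forall>s\<in>S. s divides x \<longrightarrow> P s \<Longrightarrow> P x" "\<forall>s\<in>S. s divides y \<longrightarrow> P s \<Longrightarrow> P y"
        by (simp_all add: H_def)
      have "P (x \<otimes> y)" if "\<forall>s\<in>S. s divides x \<otimes> y \<longrightarrow> P s"
      proof (rule P_mult[OF P xy]; rule ballI; rule impI)
        fix s assume s: "s \<in> S"
        then have sc: "s \<in> carrier G" using S(2) by blast
        show "P s" if "s divides x"
          using \<open>\<forall>s\<in>S. _\<close> s divides_prod_r[OF that sc xy(2)] by blast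
        show "P s" if "s divides y"
          using \<open>\<forall>s\<in>S. _\<close> s divides_prod_l[OF sc xy(2,1) that] by blast
      qed
      then show "x \<otimes> y \<in> H" using xy by (simp add: H_def)
    qed
    moreover have "S \<subseteq> H" using S(2) by (auto simp: H_def)
    ultimately have "y \<in> H" using S(3) y(1) by blast
    then show ?thesis using y(2) by (simp add: H_def)
  qed
  have P_gen: "P s" if "s \<in> S" for s
    using that
  proof (induction "card {t \<in> S. t divides s}" arbitrary: s rule: less_induct)
    case less
    then have s: "s \<in> carrier G" using S(2) by blast
    have smaller: "P x" if x: "x \<in> carrier G" "x divides s" "\<not> s divides x" for x
    proof (rule P_divisors[OF x(1)])
      fix t assume t: "t \<in> S" "t divides x"
      then have tc: "t \<in> carrier G" using S(2) by blast
      have "{u \<in> S. u divides t} \<subset> {u \<in> S. u divides s}"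
      proof
        have "t divides s" using divides_trans[OF t(2) x(2) tc] .
        then show "{u \<in> S. u divides t} \<subseteq> {u \<in> S. u divides s}"
          using S(2) divides_trans by blast
        have "\<not> s divides t" using x(3) divides_trans[OF _ t(2) s] by blast
        then show "{u \<in> S. u divides t} \<noteq> {u \<in> S. u divides s}" using less.prems s by blast
      qed
      then show "P t" using less.hyps t(1) S(1) by (simp add: psubset_card_mono)
    qed
    consider "s \<in> Units G" | "prime G s"
      | a b where "a \<in> carrier G" "b \<in> carrier G" "s divides a \<otimes> b" "\<not> s divides a" "\<not> s divides b"
      by (auto simp: prime_def)
    then show ?case
    proof cases
      case 1
      then show ?thesis by (rule P_unit)
    next
      case 2
      then show ?thesis unfolding P_def using s by (intro exI[of _ "[s]"]) auto
    next
      case 3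
      obtain x y where xy: "x \<in> carrier G" "y \<in> carrier G" "s = x \<otimes> y" "x divides a" "y divides b"
        using riesz_decomposition[OF 3(3) s 3(1,2)] .
      have "P x" "P y"
        using smaller xy 3(4,5) s divides_trans by (metis dividesI m_comm)+
      then show ?thesis using P_mult xy by simp
    qed
  qed
  show ?thesis unfolding primely_generated_def using P_divisors P_gen by (simp add: P_def)
qed

text \<open>
  The copies of a prime \<open>p\<close> below \<open>m x\<close> also lie below \<open>m y\<close>, so \<open>y\<close> contains at least as many
  copies of \<open>p\<close> as there are summands of \<open>x\<close> equivalent to \<open>p\<close>. Comparing prime decompositions,
  each prime of \<open>x\<close> is then absorbed by a prime of \<open>y\<close> or can be matched.
\<close>

lemma primely_generated_imp_unperforated:
  assumes primely_generated
  shows "unperforated G"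
  unfolding unperforated_def
proof (intro allI ballI impI)
  fix m :: nat and x y
  assume xy: "x \<in> carrier G" "y \<in> carrier G" and m: "0 < m" and d: "x [^] m divides y [^] m"
  obtain xs where xs: "set xs \<subseteq> carrier G" "\<forall>p\<in>set xs. prime G p" "x \<sim> lprod xs"
    using assms xy(1) by (auto simp: primely_generated_def)
  obtain ys where ys: "set ys \<subseteq> carrier G" "\<forall>p\<in>set ys. prime G p" "y \<sim> lprod ys"
    using assms xy(2) by (auto simp: primely_generated_def)
  have c: "lprod xs \<in> carrier G" "lprod ys \<in> carrier G" using xs ys by auto
  have "(\<exists>q\<in>set ys. p \<otimes> q divides q) \<or>
      length (filter (\<lambda>q. p \<sim> q) xs) \<le> length (filter (\<lambda>q. p \<sim> q) ys)" if p: "p \<in> set xs" for p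
  proof (rule disjCI)
    define n where "n = length (filter (\<lambda>q. p \<sim> q) xs)"
    assume "\<not> n \<le> length (filter (\<lambda>q. p \<sim> q) ys)"
    then have less: "length (filter (\<lambda>q. p \<sim> q) ys) < n" by simp
    then obtain k where k: "n = Suc k" using gr0_implies_Suc by force
    have pc: "p \<in> carrier G" "prime G p" using p xs by auto
    have "p [^] n divides x"
      using pow_count_divides_lprod[OF xs(1) pc(1)] xs(3) pc(1)
      unfolding n_def associated_def by (meson divides_trans nat_pow_closed)
    then have "(p [^] n) [^] m divides x [^] m" using pc(1) by (intro divides_pow_mono) auto
    then have "p [^] (n * m) divides y [^] m"
      using d pc(1) divides_trans by (metis nat_pow_pow nat_pow_closed)
    moreover have "m * k < n * m" using m k by simp
    ultimately have "p [^] n divides y" using prime_pow_divides_pow pc xy(2) k by blast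
    then have "p [^] n divides lprod ys"
      using ys(3) pc(1) unfolding associated_def by (meson divides_trans nat_pow_closed)
    then show "\<exists>q\<in>set ys. p \<otimes> q divides q"
      using prime_pow_divides_lprod[OF pc(2,1) ys(2,1)] less by blast
  qed
  then have "lprod xs divides lprod ys"
    using lprod_divides_lprod[of xs ys "[]"] xs(1) ys(1) c by simp
  then show "x divides y"
    using xs(3) ys(3) xy c unfolding associated_def by (meson divides_trans)
qed

text \<open>
  From \<open>x + x = y + x\<close> the prime summands of \<open>x\<close> on the right can be cancelled one by one, since each
  of them lies below \<open>x\<close> and, being below \<open>2 x = 2 y\<close>, also below \<open>y\<close>.
\<close>

lemma primely_generated_imp_separative:
  assumes primely_generated
  shows "separative G"
  unfolding separative_def
proof (intro ballI impI)
  fix x y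
  assume xy: "x \<in> carrier G" "y \<in> carrier G"
    and "x [^] (2::nat) = y [^] (2::nat) \<and> y [^] (2::nat) = x \<otimes> y"
  then have e: "x \<otimes> x = y \<otimes> y" "y \<otimes> y = x \<otimes> y" by (simp_all add: numeral_2_eq_2)
  obtain ps where ps: "set ps \<subseteq> carrier G" "\<forall>p\<in>set ps. prime G p" "x \<sim> lprod ps"
    using assms xy(1) by (auto simp: primely_generated_def)
  obtain w where w: "lprod ps = x \<otimes> w" "w \<in> carrier G" using ps(3) by (auto simp: associated_def)
  show "x = y"
  proof (rule lprod_cancel[of ps])
    have "x \<otimes> lprod ps = (x \<otimes> x) \<otimes> w" "y \<otimes> lprod ps = (x \<otimes> y) \<otimes> w"
      using w xy by (simp_all add: m_ac)
    then show "x \<otimes> lprod ps = y \<otimes> lprod ps" using e by simp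
    show "\<forall>p\<in>set ps. p \<in> carrier G \<and> prime G p \<and> p divides x \<and> p divides y"
    proof
      fix p assume p: "p \<in> set ps"
      then have pc: "p \<in> carrier G" "prime G p" using ps by auto
      have "p divides lprod ps"
        using p ps(1) by (induction ps) (auto intro: divides_prod_r divides_prod_l)
      then have px: "p divides x" using ps(3) pc divides_trans by (auto simp: associated_def)
      then have "p divides y \<otimes> y" using divides_prod_r[OF px pc(1) xy(1)] e by simp
      then have "p divides y" using pc xy by (auto elim: primeE)
      then show "p \<in> carrier G \<and> prime G p \<and> p divides x \<and> p divides y" using pc px by simp
    qed
  qed (use xy in auto)
qed

end


section \<open>Tame refinement monoids\<close>

lemma monoid_hom_pow:
  assumes "h \<in> monoid_hom M N" "comm_monoid M" "comm_monoid N" "x \<in> carrier M"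
  shows "h (x [^]\<^bsub>M\<^esub> (n::nat)) = h x [^]\<^bsub>N\<^esub> n"
proof -
  interpret M: comm_monoid M by fact
  interpret N: comm_monoid N by fact
  show ?thesis using monoid_homD[OF assms(1)] assms(4) by (induction n) simp_all
qed

lemma elementwise_limit_identify:
  assumes "elementwise_limit I r D \<phi> M \<psi>"
    and "i \<in> I" "a \<in> carrier (D i)" "b \<in> carrier (D i)" "\<psi> i a = \<psi> i b"
  shows "\<exists>j. (i, j) \<in> r \<and> \<phi> i j a = \<phi> i j b"
  using assms unfolding elementwise_limit_def by blast

text \<open>Directedness: any three elements of the limit come from one stage.\<close>

lemma elementwise_limit_common_index:
  assumes sys: "inductive_system I r D \<phi>" and lim: "elementwise_limit I r D \<phi> M \<psi>"
    and x: "x \<in> carrier M" and y: "y \<in> carrier M" and z: "z \<in> carrier M"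
  obtains i a b c where "i \<in> I" "a \<in> carrier (D i)" "b \<in> carrier (D i)" "c \<in> carrier (D i)"
    "\<psi> i a = x" "\<psi> i b = y" "\<psi> i c = z"
proof -
  note S = inductive_systemD[OF sys]
  have cc: "cocone I r D \<phi> M \<psi>"
    and surj: "\<And>x. x \<in> carrier M \<Longrightarrow> \<exists>i\<in>I. \<exists>a\<in>carrier (D i). \<psi> i a = x"
    using lim by (auto simp: elementwise_limit_def)
  have push: "\<phi> i k a \<in> carrier (D k) \<and> \<psi> k (\<phi> i k a) = \<psi> i a" if "(i, k) \<in> r" "a \<in> carrier (D i)" for i k a
    using monoid_homD(1)[OF S(9)[OF that(1)] that(2)] coconeD(3)[OF cc that] by simp
  obtain i a j b l c where ijl: "i \<in> I" "a \<in> carrier (D i)" "\<psi> i a = x"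
      "j \<in> I" "b \<in> carrier (D j)" "\<psi> j b = y" "l \<in> I" "c \<in> carrier (D l)" "\<psi> l c = z"
    using surj[OF x] surj[OF y] surj[OF z] by blast
  obtain m where m: "(i, m) \<in> r" "(j, m) \<in> r" using S(7) ijl by blast
  obtain k where k: "(m, k) \<in> r" "(l, k) \<in> r" using S(7)[OF S(3)[OF m(1)] ijl(7)] by blast
  have ik: "(i, k) \<in> r" "(j, k) \<in> r" using S(5) m k by blast+
  show ?thesis
    using that[of k "\<phi> i k a" "\<phi> j k b" "\<phi> l k c"] push[OF ik(1) ijl(2)] push[OF ik(2) ijl(5)]
      push[OF k(2) ijl(8)] ijl S(3)[OF k(1)] by simp
qed

context
  fixes M :: "('a, 'n) monoid_scheme"
  assumes tame: "tame M"
begin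

text \<open>
  An inequality \<open>m x \<le> m y\<close> is an equation between finitely many elements, so it already
  holds at some stage of the system; it can be divided by \<open>m\<close> there.
\<close>

lemma tame_unperforated: "unperforated M"
  unfolding unperforated_def
proof (intro allI ballI impI)
  obtain I r and D :: "'a list \<Rightarrow> 'a list monoid" and \<phi> \<psi> where sys: "inductive_system I r D \<phi>"
    and lim: "elementwise_limit I r D \<phi> M \<psi>"
    and fg: "\<And>i. i \<in> I \<Longrightarrow> finitely_generated_monoid (D i)"
    and ref: "\<And>i. i \<in> I \<Longrightarrow> refinement_monoid (D i)"
    using tame_obtain_elementwise_limit[OF tame] by blast
  note S = inductive_systemD[OF sys]
  have cc: "cocone I r D \<phi> M \<psi>" using lim by (simp add: elementwise_limit_def)
  interpret M: comm_monoid M using coconeD(1)[OF cc] .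
  fix m :: nat and x y
  assume xy: "x \<in> carrier M" "y \<in> carrier M" and m: "0 < m"
    and d: "(x [^]\<^bsub>M\<^esub> m) divides\<^bsub>M\<^esub> (y [^]\<^bsub>M\<^esub> m)"
  obtain z where z: "z \<in> carrier M" "x [^]\<^bsub>M\<^esub> m \<otimes>\<^bsub>M\<^esub> z = y [^]\<^bsub>M\<^esub> m" using d by (metis dividesE)
  obtain i a b c where i: "i \<in> I" "a \<in> carrier (D i)" "b \<in> carrier (D i)" "c \<in> carrier (D i)"
      "\<psi> i a = x" "\<psi> i b = y" "\<psi> i c = z"
    by (rule elementwise_limit_common_index[OF sys lim xy z(1)])
  interpret Di: comm_monoid "D i" using S(8)[OF i(1)] .
  note \<psi> = coconeD(2)[OF cc i(1)]
  have "\<psi> i (a [^]\<^bsub>D i\<^esub> m \<otimes>\<^bsub>D i\<^esub> c) = \<psi> i (b [^]\<^bsub>D i\<^esub> m)"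
    using monoid_homD(2)[OF \<psi>] monoid_hom_pow[OF \<psi> Di.comm_monoid_axioms M.comm_monoid_axioms] i z by simp
  then obtain j where j: "(i, j) \<in> r" "\<phi> i j (a [^]\<^bsub>D i\<^esub> m \<otimes>\<^bsub>D i\<^esub> c) = \<phi> i j (b [^]\<^bsub>D i\<^esub> m)"
    using elementwise_limit_identify[OF lim i(1)] Di.m_closed[OF Di.nat_pow_closed[OF i(2)] i(4)]
      Di.nat_pow_closed[OF i(3)] by blast
  have jI: "j \<in> I" using S(3)[OF j(1)] .
  interpret Dj: comm_monoid "D j" using S(8)[OF jI] .
  interpret Dj: refinement_comm_monoid "D j" using refinement_comm_monoidI[OF ref[OF jI]] .
  note \<phi> = S(9)[OF j(1)]
  have "\<phi> i j a [^]\<^bsub>D j\<^esub> m \<otimes>\<^bsub>D j\<^esub> \<phi> i j c = \<phi> i j b [^]\<^bsub>D j\<^esub> m"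
    using j(2) monoid_homD(2)[OF \<phi>] monoid_hom_pow[OF \<phi> Di.comm_monoid_axioms Dj.comm_monoid_axioms] i by simp
  then have "(\<phi> i j a [^]\<^bsub>D j\<^esub> m) divides\<^bsub>D j\<^esub> (\<phi> i j b [^]\<^bsub>D j\<^esub> m)"
    using monoid_homD(1)[OF \<phi>] i(4) by (metis dividesI)
  moreover have "unperforated (D j)"
    using Dj.primely_generated_imp_unperforated Dj.finitely_generated_imp_primely_generated fg[OF jI] by blast
  ultimately have "\<phi> i j a divides\<^bsub>D j\<^esub> \<phi> i j b"
    using m monoid_homD(1)[OF \<phi>] i unfolding unperforated_def by blast
  then obtain w where w: "w \<in> carrier (D j)" "\<phi> i j b = \<phi> i j a \<otimes>\<^bsub>D j\<^esub> w" by (metis dividesE)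
  have "\<psi> j (\<phi> i j b) = \<psi> j (\<phi> i j a) \<otimes>\<^bsub>M\<^esub> \<psi> j w"
    using w monoid_homD(2)[OF coconeD(2)[OF cc jI]] monoid_homD(1)[OF \<phi>] i by simp
  then have "y = x \<otimes>\<^bsub>M\<^esub> \<psi> j w" using coconeD(3)[OF cc j(1)] i by simp
  then show "x divides\<^bsub>M\<^esub> y" using monoid_homD(1)[OF coconeD(2)[OF cc jI] w(1)] by (rule dividesI')
qed

lemma tame_separative: "separative M"
  unfolding separative_def
proof (intro ballI impI)
  obtain I r and D :: "'a list \<Rightarrow> 'a list monoid" and \<phi> \<psi> where sys: "inductive_system I r D \<phi>"
    and lim: "elementwise_limit I r D \<phi> M \<psi>"
    and fg: "\<And>i. i \<in> I \<Longrightarrow> finitely_generated_monoid (D i)"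
    and ref: "\<And>i. i \<in> I \<Longrightarrow> refinement_monoid (D i)"
    using tame_obtain_elementwise_limit[OF tame] by blast
  note S = inductive_systemD[OF sys]
  have cc: "cocone I r D \<phi> M \<psi>" using lim by (simp add: elementwise_limit_def)
  note idn = elementwise_limit_identify[OF lim]
  interpret M: comm_monoid M using coconeD(1)[OF cc] .
  fix x y
  assume xy: "x \<in> carrier M" "y \<in> carrier M"
    and e: "x [^]\<^bsub>M\<^esub> (2::nat) = y [^]\<^bsub>M\<^esub> (2::nat) \<and> y [^]\<^bsub>M\<^esub> (2::nat) = x \<otimes>\<^bsub>M\<^esub> y"
  obtain i a b c where i: "i \<in> I" "a \<in> carrier (D i)" "b \<in> carrier (D i)" "c \<in> carrier (D i)"
      "\<psi> i a = x" "\<psi> i b = y" "\<psi> i c = y"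
    by (rule elementwise_limit_common_index[OF sys lim xy xy(2)])
  interpret Di: comm_monoid "D i" using S(8)[OF i(1)] .
  note \<psi> = coconeD(2)[OF cc i(1)]
  note \<psi>_simps = monoid_homD(2)[OF \<psi>] monoid_hom_pow[OF \<psi> Di.comm_monoid_axioms M.comm_monoid_axioms]
  obtain j where j: "(i, j) \<in> r" "\<phi> i j (a [^]\<^bsub>D i\<^esub> (2::nat)) = \<phi> i j (b [^]\<^bsub>D i\<^esub> (2::nat))"
    using idn[OF i(1) Di.nat_pow_closed[OF i(2)] Di.nat_pow_closed[OF i(3)]] i e \<psi>_simps by metis
  obtain k where k: "(i, k) \<in> r" "\<phi> i k (b [^]\<^bsub>D i\<^esub> (2::nat)) = \<phi> i k (a \<otimes>\<^bsub>D i\<^esub> b)"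
    using idn[OF i(1) Di.nat_pow_closed[OF i(3)] Di.m_closed[OF i(2,3)]] i e \<psi>_simps by metis
  obtain l where l: "(j, l) \<in> r" "(k, l) \<in> r" using S(7)[OF S(3)[OF j(1)] S(3)[OF k(1)]] by blast
  have il: "(i, l) \<in> r" and lI: "l \<in> I" using S(3,5) j(1) l(1) by blast+
  have "\<phi> i l (a [^]\<^bsub>D i\<^esub> (2::nat)) = \<phi> i l (b [^]\<^bsub>D i\<^esub> (2::nat))"
    using S(11)[OF j(1) l(1)] j(2) Di.nat_pow_closed i(2,3) by metis
  moreover have "\<phi> i l (b [^]\<^bsub>D i\<^esub> (2::nat)) = \<phi> i l (a \<otimes>\<^bsub>D i\<^esub> b)"
    using S(11)[OF k(1) l(2)] k(2) Di.nat_pow_closed Di.m_closed i(2,3) by metis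
  moreover interpret Dl: comm_monoid "D l" using S(8)[OF lI] .
  interpret Dl: refinement_comm_monoid "D l" using refinement_comm_monoidI[OF ref[OF lI]] .
  note \<phi> = S(9)[OF il]
  ultimately have "\<phi> i l a [^]\<^bsub>D l\<^esub> (2::nat) = \<phi> i l b [^]\<^bsub>D l\<^esub> (2::nat) \<and>
      \<phi> i l b [^]\<^bsub>D l\<^esub> (2::nat) = \<phi> i l a \<otimes>\<^bsub>D l\<^esub> \<phi> i l b"
    using monoid_homD(2)[OF \<phi>] monoid_hom_pow[OF \<phi> Di.comm_monoid_axioms Dl.comm_monoid_axioms] i(2,3) by simp
  moreover have "separative (D l)"
    using Dl.primely_generated_imp_separative Dl.finitely_generated_imp_primely_generated fg[OF lI] by blast
  ultimately have "\<phi> i l a = \<phi> i l b"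
    using monoid_homD(1)[OF \<phi>] i(2,3) unfolding separative_def by blast
  then show "x = y" using coconeD(3)[OF cc il] i by metis
qed

end

section \<open>Context-free presentations\<close>

inductive rewrite_step :: "'g set \<Rightarrow> 'g multiset rel \<Rightarrow> 'g multiset \<Rightarrow> 'g multiset \<Rightarrow> bool"
  for X :: "'g set" and R :: "'g multiset rel" where
  "(l, b) \<in> R \<Longrightarrow> set_mset c \<subseteq> X \<Longrightarrow> rewrite_step X R (l + c) (b + c)"

text \<open>
  Commutative context-free grammars. As rules rewrite single generators, distinct redexes never
  overlap, so that confluence only has to be required for pairs of rules for the same generator. The
  bound of one step on either side makes this local condition sufficient without any termination
  assumption.
\<close>

locale context_free_presentation =
  fixes X :: "'g set" and R :: "'g multiset rel"
  assumes relations: "R \<subseteq> {a. set_mset a \<subseteq> X} \<times> {a. set_mset a \<subseteq> X}"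
    and singleton: "(l, b) \<in> R \<Longrightarrow> \<exists>x. l = {#x#}"
    and diamond: "({#x#}, b) \<in> R \<Longrightarrow> ({#x#}, b') \<in> R \<Longrightarrow>
      \<exists>d. (rewrite_step X R)\<^sup>=\<^sup>= b d \<and> (rewrite_step X R)\<^sup>=\<^sup>= b' d"
begin

abbreviation step (infix "\<rightarrow>" 50) where "a \<rightarrow> b \<equiv> rewrite_step X R a b"
abbreviation steps (infix "\<rightarrow>*" 50) where "a \<rightarrow>* b \<equiv> (rewrite_step X R)\<^sup>*\<^sup>* a b"

lemma step_add:
  assumes "a \<rightarrow> b" "set_mset c \<subseteq> X"
  shows "a + c \<rightarrow> b + c"
  using assms
proof (cases rule: rewrite_step.cases)
  case (1 l b' d)
  then show ?thesis
    using rewrite_step.intros[of l b' R "d + c" X] assms(2) by (simp add: add.assoc)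
qed

lemma steps_add:
  assumes "a \<rightarrow>* b" "set_mset c \<subseteq> X"
  shows "a + c \<rightarrow>* b + c"
  using assms(1)
proof (induction rule: rtranclp_induct)
  case (step y z)
  then show ?case using step_add[OF _ assms(2)] by (meson rtranclp.rtrancl_into_rtrancl)
qed simp

lemma step_cases:
  assumes "a \<rightarrow> b"
  obtains x rhs c where "({#x#}, rhs) \<in> R" "set_mset c \<subseteq> X" "a = add_mset x c" "b = rhs + c"
  using assms
proof (cases rule: rewrite_step.cases)
  case (1 l rhs c)
  moreover obtain x where "l = {#x#}" using singleton 1(3) by blast
  ultimately show ?thesis using that[of x rhs c] by simp
qed

lemma step_closed: "a \<rightarrow> b \<Longrightarrow> set_mset b \<subseteq> X"
  by (elim step_cases) (use relations in auto)

lemma steps_closed: "a \<rightarrow>* b \<Longrightarrow> set_mset a \<subseteq> X \<Longrightarrow> set_mset b \<subseteq> X"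
  by (induction rule: rtranclp_induct) (auto dest: step_closed)

text \<open>
  Steps at different summands commute, and steps at the same summand can be joined by assumption.
\<close>

lemma step_diamond:
  assumes "a \<rightarrow> b" "a \<rightarrow> b'"
  shows "\<exists>d. (\<rightarrow>)\<^sup>=\<^sup>= b d \<and> (\<rightarrow>)\<^sup>=\<^sup>= b' d"
proof -
  obtain x rhs c where x: "({#x#}, rhs) \<in> R" "set_mset c \<subseteq> X" "a = add_mset x c" "b = rhs + c"
    using assms(1) by (rule step_cases)
  obtain y rhs' c' where y: "({#y#}, rhs') \<in> R" "set_mset c' \<subseteq> X" "a = add_mset y c'" "b' = rhs' + c'"
    using assms(2) by (rule step_cases)
  have closed: "set_mset rhs \<subseteq> X" "set_mset rhs' \<subseteq> X" using relations x y by auto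
  consider "x = y" "c = c'" | k where "c = add_mset y k" "c' = add_mset x k"
    using x(3) y(3) by (auto simp: add_eq_conv_ex)
  then show ?thesis
  proof cases
    case 1
    then obtain d where "(\<rightarrow>)\<^sup>=\<^sup>= rhs d" "(\<rightarrow>)\<^sup>=\<^sup>= rhs' d" using diamond x(1) y(1) by blast
    then have "(\<rightarrow>)\<^sup>=\<^sup>= b (d + c)" "(\<rightarrow>)\<^sup>=\<^sup>= b' (d + c)"
      using step_add[OF _ x(2)] x(4) y(4) 1 by auto
    then show ?thesis by blast
  next
    case 2
    have "b \<rightarrow> rhs + rhs' + k"
      using rewrite_step.intros[OF y(1), of "rhs + k" X] closed x(2,4) 2 by (simp add: ac_simps)
    moreover have "b' \<rightarrow> rhs + rhs' + k"
      using rewrite_step.intros[OF x(1), of "rhs' + k" X] closed x(2) y(4) 2 by (simp add: ac_simps)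
    ultimately show ?thesis by blast
  qed
qed

lemma confluent: "confluentp (\<rightarrow>)"
proof (intro strong_confluentp_imp_confluentp strong_confluentpI)
  fix a b b' assume "a \<rightarrow> b" "a \<rightarrow> b'"
  then show "\<exists>d. b \<rightarrow>* d \<and> (\<rightarrow>)\<^sup>=\<^sup>= b' d" using step_diamond by blast
qed

lemma steps_congruent:
  assumes "a \<rightarrow>* b" "set_mset a \<subseteq> X"
  shows "(a, b) \<in> congruence_closure X R"
  using assms(1)
proof (induction rule: rtranclp_induct)
  case base
  show ?case using assms(2) by (rule congruence_closure.refl)
next
  case (step y z)
  have "(y, z) \<in> congruence_closure X R"
    using step(2) by (cases rule: rewrite_step.cases) (auto intro: congruence_closure.base congruence_closure.add)
  then show ?case using step(3) by (rule congruence_closure.trans[rotated])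
qed

text \<open>The Church-Rosser property.\<close>

lemma congruent_iff_joinable:
  "(a, b) \<in> congruence_closure X R \<longleftrightarrow>
    set_mset a \<subseteq> X \<and> set_mset b \<subseteq> X \<and> (\<exists>c. a \<rightarrow>* c \<and> b \<rightarrow>* c)"
proof
  assume ab: "(a, b) \<in> congruence_closure X R"
  then have "\<exists>c. a \<rightarrow>* c \<and> b \<rightarrow>* c"
  proof (induction rule: congruence_closure.induct)
    case (base a b)
    then have "a \<rightarrow> b" using rewrite_step.intros[of a b R "{#}" X] by simp
    then show ?case by blast
  next
    case (trans a b c)
    then obtain d d' where "a \<rightarrow>* d" "b \<rightarrow>* d" "b \<rightarrow>* d'" "c \<rightarrow>* d'" by blast
    moreover from this obtain e where "d \<rightarrow>* e" "d' \<rightarrow>* e" using confluentpD[OF confluent] by meson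
    ultimately show ?case by (meson rtranclp_trans)
  next
    case (add a b c)
    then show ?case using steps_add by meson
  qed blast+
  then show "set_mset a \<subseteq> X \<and> set_mset b \<subseteq> X \<and> (\<exists>c. a \<rightarrow>* c \<and> b \<rightarrow>* c)"
    using congruence_closure_subset[OF relations] ab by blast
next
  assume "set_mset a \<subseteq> X \<and> set_mset b \<subseteq> X \<and> (\<exists>c. a \<rightarrow>* c \<and> b \<rightarrow>* c)"
  then show "(a, b) \<in> congruence_closure X R"
    using steps_congruent by (meson congruence_closure.sym congruence_closure.trans)
qed

text \<open>Since a step rewrites a single generator, it takes place inside one of the two summands.\<close>

lemma steps_split:
  assumes "a1 + a2 \<rightarrow>* c"
  obtains c1 c2 where "c = c1 + c2" "a1 \<rightarrow>* c1" "a2 \<rightarrow>* c2"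
proof -
  from assms have "\<exists>c1 c2. c = c1 + c2 \<and> a1 \<rightarrow>* c1 \<and> a2 \<rightarrow>* c2"
  proof (induction rule: rtranclp_induct)
    case base
    then show ?case by blast
  next
    case (step y z)
    then obtain c1 c2 where c: "y = c1 + c2" "a1 \<rightarrow>* c1" "a2 \<rightarrow>* c2" by blast
    obtain x rhs d where x: "({#x#}, rhs) \<in> R" "set_mset d \<subseteq> X" "y = add_mset x d" "z = rhs + d"
      using step(2) by (rule step_cases)
    have "x \<in># c1 + c2" using x(3) c(1) by (metis union_single_eq_member add_mset_add_single union_commute)
    then consider k where "c1 = add_mset x k" | k where "c2 = add_mset x k"
      by (metis mset_add union_iff)
    then show ?case
    proof cases
      case 1
      then have d: "d = k + c2" using x(3) c(1) by simp
      have "c1 \<rightarrow> rhs + k" using rewrite_step.intros[OF x(1), of k X] 1 x(2) d by simp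
      then have "a1 \<rightarrow>* rhs + k" using c(2) by simp
      then show ?thesis using c(3) x(4) d by (metis union_assoc)
    next
      case 2
      then have d: "d = c1 + k" using x(3) c(1) by simp
      have "c2 \<rightarrow> rhs + k" using rewrite_step.intros[OF x(1), of k X] 2 x(2) d by simp
      then have "a2 \<rightarrow>* rhs + k" using c(3) by simp
      then show ?thesis using c(2) x(4) d by (metis union_assoc union_commute)
    qed
  qed
  then show ?thesis using that by blast
qed

end

lemma multiset_refinement:
  fixes a1 a2 b1 b2 :: "'g multiset"
  assumes "a1 + a2 = b1 + b2"
  obtains z11 z12 z21 z22 where "a1 = z11 + z12" "a2 = z21 + z22" "b1 = z11 + z21" "b2 = z12 + z22"
proof
  \<comment> \<open>Take \<open>z11\<close> as large as possible, that is \<open>a1 \<inter># b1\<close>.\<close>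
  have "count a1 x + count a2 x = count b1 x + count b2 x" for x
    using assms by (metis count_union)
  note c = this
  have "count a2 x = (count b1 x - count a1 x) + (count a2 x - (count b1 x - count a1 x))" for x
    using c[of x] by linarith
  then show "a2 = (b1 - a1) + (a2 - (b1 - a1))" by (simp add: multiset_eq_iff)
  have "count b2 x = (count a1 x - count b1 x) + (count a2 x - (count b1 x - count a1 x))" for x
    using c[of x] by linarith
  then show "b2 = (a1 - b1) + (a2 - (b1 - a1))" by (simp add: multiset_eq_iff)
  show "a1 = (a1 \<inter># b1) + (a1 - b1)" "b1 = (a1 \<inter># b1) + (b1 - a1)"
    by (auto simp: multiset_eq_iff)
qed

lemma carrier_presented_monoid:
  "carrier (presented_monoid X R) = (\<lambda>a. congruence_closure X R `` {a}) ` {a. set_mset a \<subseteq> X}"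
  by (auto simp: presented_monoid_def quotient_def)

lemma one_presented_monoid: "\<one>\<^bsub>presented_monoid X R\<^esub> = congruence_closure X R `` {{#}}"
  by (simp add: presented_monoid_def)

lemma congruence_class_eq_iff:
  assumes "R \<subseteq> {a. set_mset a \<subseteq> X} \<times> {a. set_mset a \<subseteq> X}" "set_mset a \<subseteq> X" "set_mset b \<subseteq> X"
  shows "congruence_closure X R `` {a} = congruence_closure X R `` {b} \<longleftrightarrow> (a, b) \<in> congruence_closure X R"
  using eq_equiv_class_iff[OF congruence_closure_equiv[OF assms(1)]] assms(2,3) by simp

text \<open>
  An equation \<open>x1 + x2 = y1 + y2\<close> is witnessed by a common reduct, which splits according to both
  sides. The two splittings have a common refinement in the free commutative monoid.
\<close>

theorem (in context_free_presentation) refinement_presented_monoid: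
  "refinement_monoid (presented_monoid X R)"
proof -
  let ?c = "\<lambda>a. congruence_closure X R `` {a}"
  have "\<exists>z11\<in>carrier (presented_monoid X R). \<exists>z12\<in>carrier (presented_monoid X R).
      \<exists>z21\<in>carrier (presented_monoid X R). \<exists>z22\<in>carrier (presented_monoid X R).
        x1 = z11 \<otimes>\<^bsub>presented_monoid X R\<^esub> z12 \<and> x2 = z21 \<otimes>\<^bsub>presented_monoid X R\<^esub> z22 \<and>
        y1 = z11 \<otimes>\<^bsub>presented_monoid X R\<^esub> z21 \<and> y2 = z12 \<otimes>\<^bsub>presented_monoid X R\<^esub> z22"
    if car: "x1 \<in> carrier (presented_monoid X R)" "x2 \<in> carrier (presented_monoid X R)"
      "y1 \<in> carrier (presented_monoid X R)" "y2 \<in> carrier (presented_monoid X R)"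
      and eq: "x1 \<otimes>\<^bsub>presented_monoid X R\<^esub> x2 = y1 \<otimes>\<^bsub>presented_monoid X R\<^esub> y2"
    for x1 x2 y1 y2
  proof -
    obtain a1 a2 b1 b2 where a: "set_mset a1 \<subseteq> X" "x1 = ?c a1" "set_mset a2 \<subseteq> X" "x2 = ?c a2"
      and b: "set_mset b1 \<subseteq> X" "y1 = ?c b1" "set_mset b2 \<subseteq> X" "y2 = ?c b2"
      using car unfolding carrier_presented_monoid by blast
    have "(a1 + a2, b1 + b2) \<in> congruence_closure X R"
      using eq a b by (simp add: presented_monoid_mult[OF relations] congruence_class_eq_iff[OF relations])
    then obtain c where c: "a1 + a2 \<rightarrow>* c" "b1 + b2 \<rightarrow>* c" by (auto simp: congruent_iff_joinable)
    obtain a1' a2' where a': "c = a1' + a2'" "a1 \<rightarrow>* a1'" "a2 \<rightarrow>* a2'" using c(1) by (rule steps_split)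
    obtain b1' b2' where b': "c = b1' + b2'" "b1 \<rightarrow>* b1'" "b2 \<rightarrow>* b2'" using c(2) by (rule steps_split)
    obtain z11 z12 z21 z22 where z: "a1' = z11 + z12" "a2' = z21 + z22" "b1' = z11 + z21" "b2' = z12 + z22"
      using multiset_refinement a'(1) b'(1) by metis
    have cong: "?c d = ?c d'" if "set_mset d \<subseteq> X" "d \<rightarrow>* d'" for d d'
      using that steps_congruent steps_closed by (simp add: congruence_class_eq_iff[OF relations])
    have "set_mset a1' \<subseteq> X" "set_mset a2' \<subseteq> X" using steps_closed a a' by blast+
    then have X: "set_mset z11 \<subseteq> X" "set_mset z12 \<subseteq> X" "set_mset z21 \<subseteq> X" "set_mset z22 \<subseteq> X"
      using z by auto
    have "x1 = ?c (z11 + z12)" "x2 = ?c (z21 + z22)" "y1 = ?c (z11 + z21)" "y2 = ?c (z12 + z22)"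
      using cong a b a' b' z by simp_all
    then show ?thesis
      using X by (intro bexI[of _ "?c z11"] bexI[of _ "?c z12"] bexI[of _ "?c z21"] bexI[of _ "?c z22"])
        (simp_all add: presented_monoid_mult[OF relations] carrier_presented_monoid)
  qed
  then show ?thesis
    unfolding refinement_monoid_def using presented_monoid_comm_monoid[OF relations] by blast
qed

text \<open>If no relation involves the empty sum, only the empty sum is congruent to it.\<close>

lemma presented_monoid_conical:
  assumes R: "R \<subseteq> {a. set_mset a \<subseteq> X} \<times> {a. set_mset a \<subseteq> X}"
    and nonempty: "\<And>a b. (a, b) \<in> R \<Longrightarrow> a \<noteq> {#} \<and> b \<noteq> {#}"
  shows "conical (presented_monoid X R)"
  unfolding conical_def
proof (intro ballI impI)
  have empty: "a = {#} \<longleftrightarrow> b = {#}" if "(a, b) \<in> congruence_closure X R" for a b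
    using that by (induction rule: congruence_closure.induct) (use nonempty in auto)
  fix x y
  assume "x \<in> carrier (presented_monoid X R)" "y \<in> carrier (presented_monoid X R)"
    and e: "x \<otimes>\<^bsub>presented_monoid X R\<^esub> y = \<one>\<^bsub>presented_monoid X R\<^esub>"
  then obtain a b where ab: "set_mset a \<subseteq> X" "x = congruence_closure X R `` {a}"
      "set_mset b \<subseteq> X" "y = congruence_closure X R `` {b}"
    unfolding carrier_presented_monoid by blast
  then have "(a + b, {#}) \<in> congruence_closure X R"
    using e by (simp add: presented_monoid_mult[OF R] one_presented_monoid congruence_class_eq_iff[OF R])
  then have "a + b = {#}" using empty by blast
  then show "x = \<one>\<^bsub>presented_monoid X R\<^esub> \<and> y = \<one>\<^bsub>presented_monoid X R\<^esub>"
    using ab by (simp add: one_presented_monoid)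
qed

lemma presented_monoid_finitely_generated:
  assumes R: "R \<subseteq> {a. set_mset a \<subseteq> X} \<times> {a. set_mset a \<subseteq> X}" and "finite X"
  shows "finitely_generated_monoid (presented_monoid X R)"
  unfolding finitely_generated_monoid_def
proof (intro exI[of _ "(\<lambda>x. congruence_closure X R `` {{#x#}}) ` X"] conjI allI impI)
  let ?c = "\<lambda>a. congruence_closure X R `` {a}"
  show "finite ((\<lambda>x. ?c {#x#}) ` X)" using assms(2) by simp
  show "(\<lambda>x. ?c {#x#}) ` X \<subseteq> carrier (presented_monoid X R)"
    unfolding carrier_presented_monoid by (intro image_subsetI imageI) simp
  fix H assume H: "submonoid H (presented_monoid X R) \<and> (\<lambda>x. ?c {#x#}) ` X \<subseteq> H"
  then interpret H: submonoid H "presented_monoid X R" by blast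
  have "?c a \<in> H" if "set_mset a \<subseteq> X" for a
    using that
  proof (induction a)
    case empty
    then show ?case using H.one_closed by (simp add: one_presented_monoid)
  next
    case (add x a)
    then have "?c {#x#} \<otimes>\<^bsub>presented_monoid X R\<^esub> ?c a \<in> H" using H by (intro H.m_closed) auto
    then show ?case using add.prems presented_monoid_mult[OF R, of "{#x#}" a] by simp
  qed
  then show "H = carrier (presented_monoid X R)"
    using H.subset by (auto simp: carrier_presented_monoid)
qed

section \<open>Presented monoids as inductive limits\<close>

definition restrict_relations :: "'g set \<Rightarrow> 'g multiset rel \<Rightarrow> 'g multiset rel"
  where "restrict_relations Y R = R \<inter> {a. set_mset a \<subseteq> Y} \<times> {a. set_mset a \<subseteq> Y}"

lemma restrict_relations_subset: "restrict_relations Y R \<subseteq> {a. set_mset a \<subseteq> Y} \<times> {a. set_mset a \<subseteq> Y}"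
  by (simp add: restrict_relations_def)

lemma restrict_relations_mono: "Y \<subseteq> Z \<Longrightarrow> restrict_relations Y R \<subseteq> restrict_relations Z R"
  by (auto simp: restrict_relations_def)

lemma congruence_closure_mono:
  assumes "Y \<subseteq> Z" "R \<subseteq> R'"
  shows "congruence_closure Y R \<subseteq> congruence_closure Z R'"
proof -
  have "(a, b) \<in> congruence_closure Z R'" if "(a, b) \<in> congruence_closure Y R" for a b
    using that
  proof (induction rule: congruence_closure.induct)
    case (trans a b c)
    then show ?case by (meson congruence_closure.trans)
  qed (use assms in \<open>auto intro: congruence_closure.base congruence_closure.refl
      congruence_closure.sym congruence_closure.add\<close>)
  then show ?thesis by auto
qed

lemma restricted_congruence_mono:
  assumes "Y \<subseteq> Z" "(a, b) \<in> congruence_closure Y (restrict_relations Y R)"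
  shows "(a, b) \<in> congruence_closure Z (restrict_relations Z R)"
  using congruence_closure_mono[OF assms(1) restrict_relations_mono[OF assms(1)]] assms(2) by blast

text \<open>
  The homomorphism induced by an inclusion of presentations sends a class to its saturation, that is
  to its image under the larger congruence.
\<close>

lemma congruence_closure_Image_class:
  assumes "Y \<subseteq> Z" "R \<subseteq> R'" "set_mset a \<subseteq> Y"
  shows "congruence_closure Z R' `` (congruence_closure Y R `` {a}) = congruence_closure Z R' `` {a}"
proof -
  have "(a, a) \<in> congruence_closure Y R" using assms(3) by (rule congruence_closure.refl)
  then show ?thesis
    using congruence_closure_mono[OF assms(1,2)] by (blast intro: congruence_closure.trans)
qed

lemma presented_monoid_hom:
  assumes YZ: "Y \<subseteq> Z" "R \<subseteq> R'" and R: "R \<subseteq> {a. set_mset a \<subseteq> Y} \<times> {a. set_mset a \<subseteq> Y}"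
    and R': "R' \<subseteq> {a. set_mset a \<subseteq> Z} \<times> {a. set_mset a \<subseteq> Z}"
  shows "(\<lambda>C. congruence_closure Z R' `` C) \<in> monoid_hom (presented_monoid Y R) (presented_monoid Z R')"
proof (rule monoid_homI)
  note im = congruence_closure_Image_class[OF YZ]
  show "congruence_closure Z R' `` \<one>\<^bsub>presented_monoid Y R\<^esub> = \<one>\<^bsub>presented_monoid Z R'\<^esub>"
    by (simp add: one_presented_monoid im)
  fix x assume "x \<in> carrier (presented_monoid Y R)"
  then obtain a where a: "set_mset a \<subseteq> Y" "x = congruence_closure Y R `` {a}"
    by (auto simp: carrier_presented_monoid)
  then have aZ: "set_mset a \<subseteq> Z" using YZ by blast
  then show "congruence_closure Z R' `` x \<in> carrier (presented_monoid Z R')"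
    using a by (auto simp: carrier_presented_monoid im)
  fix y assume "y \<in> carrier (presented_monoid Y R)"
  then obtain b where b: "set_mset b \<subseteq> Y" "y = congruence_closure Y R `` {b}"
    by (auto simp: carrier_presented_monoid)
  then have bZ: "set_mset b \<subseteq> Z" using YZ by blast
  show "congruence_closure Z R' `` (x \<otimes>\<^bsub>presented_monoid Y R\<^esub> y) =
      congruence_closure Z R' `` x \<otimes>\<^bsub>presented_monoid Z R'\<^esub> congruence_closure Z R' `` y"
    using a b by (simp add: presented_monoid_mult[OF R] presented_monoid_mult[OF R' aZ bZ] im)
qed

context
  fixes X :: "'g set" and R :: "'g multiset rel" and \<F> :: "'g set set"
  assumes R: "R \<subseteq> {a. set_mset a \<subseteq> X} \<times> {a. set_mset a \<subseteq> X}"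
    and members: "\<And>Y. Y \<in> \<F> \<Longrightarrow> finite Y \<and> Y \<subseteq> X"
    and cofinal: "\<And>F. finite F \<Longrightarrow> F \<subseteq> X \<Longrightarrow> \<exists>Y\<in>\<F>. F \<subseteq> Y"
begin

text \<open>
  The presentations restricted to the sets in \<open>\<F>\<close> form an inductive system, ordered by
  inclusion, with limit the whole presentation.
\<close>

private definition "D Y = presented_monoid Y (restrict_relations Y R)"
private definition "\<phi> Y Z C = congruence_closure Z (restrict_relations Z R) `` C"
private definition "r = {(Y, Z). Y \<in> \<F> \<and> Z \<in> \<F> \<and> Y \<subseteq> Z}"

text \<open>The derivation of a congruence uses finitely many generators.\<close>

lemma congruence_in_member:
  assumes "(a, b) \<in> congruence_closure X R"
  shows "\<exists>Y\<in>\<F>. (a, b) \<in> congruence_closure Y (restrict_relations Y R)"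
  using assms
proof (induction rule: congruence_closure.induct)
  case (base a b)
  then have "finite (set_mset a \<union> set_mset b)" "set_mset a \<union> set_mset b \<subseteq> X" using R by auto
  then obtain Y where "Y \<in> \<F>" "set_mset a \<union> set_mset b \<subseteq> Y" using cofinal by blast
  then show ?case using base
    by (intro bexI[of _ Y] congruence_closure.base) (auto simp: restrict_relations_def)
next
  case (refl a)
  then obtain Y where "Y \<in> \<F>" "set_mset a \<subseteq> Y" using cofinal[of "set_mset a"] by auto
  then show ?case by (auto intro: congruence_closure.refl)
next
  case (sym a b)
  then show ?case by (auto intro: congruence_closure.sym)
next
  case (trans a b c)
  then obtain Y Y' where Y: "Y \<in> \<F>" "(a, b) \<in> congruence_closure Y (restrict_relations Y R)"
      "Y' \<in> \<F>" "(b, c) \<in> congruence_closure Y' (restrict_relations Y' R)" by blast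
  then obtain Z where Z: "Z \<in> \<F>" "Y \<subseteq> Z" "Y' \<subseteq> Z"
    using cofinal[of "Y \<union> Y'"] members[of Y] members[of Y'] by auto
  then have "(a, b) \<in> congruence_closure Z (restrict_relations Z R)"
    "(b, c) \<in> congruence_closure Z (restrict_relations Z R)"
    using Y(2,4) restricted_congruence_mono[OF Z(2)] restricted_congruence_mono[OF Z(3)] by simp_all
  then show ?case using Z(1) congruence_closure.trans by blast
next
  case (add a b c)
  then obtain Y where Y: "Y \<in> \<F>" "(a, b) \<in> congruence_closure Y (restrict_relations Y R)" by blast
  then obtain Z where Z: "Z \<in> \<F>" "Y \<subseteq> Z" "set_mset c \<subseteq> Z"
    using cofinal[of "Y \<union> set_mset c"] members[of Y] add.hyps(2) by auto
  then have "(a, b) \<in> congruence_closure Z (restrict_relations Z R)"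
    using Y(2) restricted_congruence_mono[OF Z(2)] by simp
  then show ?case using Z congruence_closure.add by blast
qed

lemma inductive_system_restrictions: "inductive_system \<F> r D \<phi>"
  unfolding inductive_system_def
proof (intro conjI)
  show "\<F> \<noteq> {}" using cofinal[of "{}"] by auto
  show "partial_order_on \<F> r"
    by (auto simp: r_def partial_order_on_def preorder_on_def refl_on_def trans_def antisym_def)
  show "\<forall>Y\<in>\<F>. \<forall>Y'\<in>\<F>. \<exists>Z\<in>\<F>. (Y, Z) \<in> r \<and> (Y', Z) \<in> r"
  proof (intro ballI)
    fix Y Y' assume Y: "Y \<in> \<F>" "Y' \<in> \<F>"
    then obtain Z where "Z \<in> \<F>" "Y \<union> Y' \<subseteq> Z" using cofinal[of "Y \<union> Y'"] members by auto
    then show "\<exists>Z\<in>\<F>. (Y, Z) \<in> r \<and> (Y', Z) \<in> r" using Y by (auto simp: r_def)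
  qed
  show "\<forall>Y\<in>\<F>. comm_monoid (D Y)"
    by (simp add: D_def presented_monoid_comm_monoid restrict_relations_subset)
  show "\<forall>(Y, Z)\<in>r. \<phi> Y Z \<in> monoid_hom (D Y) (D Z)"
    unfolding r_def \<phi>_def D_def
    using presented_monoid_hom[OF _ restrict_relations_mono restrict_relations_subset restrict_relations_subset]
    by auto
  show "\<forall>Y\<in>\<F>. \<forall>C\<in>carrier (D Y). \<phi> Y Y C = C"
    by (auto simp: \<phi>_def D_def carrier_presented_monoid congruence_closure_Image_class)
  show "\<forall>U V W. (U, V) \<in> r \<longrightarrow> (V, W) \<in> r \<longrightarrow> (\<forall>C\<in>carrier (D U). \<phi> V W (\<phi> U V C) = \<phi> U W C)"
  proof (intro allI impI ballI)
    fix U V W C assume UVW: "(U, V) \<in> r" "(V, W) \<in> r" and "C \<in> carrier (D U)"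
    then obtain a where a: "set_mset a \<subseteq> U" "C = congruence_closure U (restrict_relations U R) `` {a}"
      by (auto simp: D_def carrier_presented_monoid)
    have sub: "U \<subseteq> V" "V \<subseteq> W" "U \<subseteq> W" using UVW by (auto simp: r_def)
    then have aV: "set_mset a \<subseteq> V" using a by blast
    show "\<phi> V W (\<phi> U V C) = \<phi> U W C"
      unfolding \<phi>_def a(2)
      using a aV by (simp only: congruence_closure_Image_class sub restrict_relations_mono)
  qed
qed

lemma elementwise_limit_restrictions:
  "elementwise_limit \<F> r D \<phi> (presented_monoid X R) (\<lambda>Y C. congruence_closure X R `` C)"
  unfolding elementwise_limit_def cocone_def
proof (intro conjI)
  have res: "restrict_relations Y R \<subseteq> R" for Y by (auto simp: restrict_relations_def)
  have sub: "Y \<subseteq> X" if "Y \<in> \<F>" for Y using members that by blast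
  note im = congruence_closure_Image_class[OF sub res]
  show "comm_monoid (presented_monoid X R)" using R by (rule presented_monoid_comm_monoid)
  show "\<forall>Y\<in>\<F>. (\<lambda>C. congruence_closure X R `` C) \<in> monoid_hom (D Y) (presented_monoid X R)"
    unfolding D_def using presented_monoid_hom[OF sub res restrict_relations_subset R] by blast
  have "congruence_closure X R `` \<phi> Y Z C = congruence_closure X R `` C"
    if YZ: "(Y, Z) \<in> r" and C: "C \<in> carrier (D Y)" for Y Z C
  proof -
    obtain a where a: "set_mset a \<subseteq> Y" "C = congruence_closure Y (restrict_relations Y R) `` {a}"
      using C by (auto simp: D_def carrier_presented_monoid)
    have Y: "Y \<in> \<F>" "Z \<in> \<F>" "Y \<subseteq> Z" using YZ by (auto simp: r_def)
    then have aZ: "set_mset a \<subseteq> Z" using a by blast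
    have "\<phi> Y Z C = congruence_closure Z (restrict_relations Z R) `` {a}"
      unfolding \<phi>_def a(2)
      using a by (simp only: congruence_closure_Image_class Y restrict_relations_mono)
    then show ?thesis using a aZ Y by (simp only: im)
  qed
  then show "\<forall>(Y, Z)\<in>r. \<forall>C\<in>carrier (D Y). congruence_closure X R `` \<phi> Y Z C = congruence_closure X R `` C"
    by blast
  show "\<forall>C\<in>carrier (presented_monoid X R). \<exists>Y\<in>\<F>. \<exists>C'\<in>carrier (D Y). congruence_closure X R `` C' = C"
  proof
    fix C assume "C \<in> carrier (presented_monoid X R)"
    then obtain a where a: "set_mset a \<subseteq> X" "C = congruence_closure X R `` {a}"
      by (auto simp: carrier_presented_monoid)
    then obtain Y where Y: "Y \<in> \<F>" "set_mset a \<subseteq> Y" using cofinal[of "set_mset a"] by auto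
    show "\<exists>Y\<in>\<F>. \<exists>C'\<in>carrier (D Y). congruence_closure X R `` C' = C"
      using Y a by (intro bexI[of _ Y] bexI[of _ "congruence_closure Y (restrict_relations Y R) `` {a}"])
        (auto simp: im D_def carrier_presented_monoid)
  qed
  show "\<forall>Y\<in>\<F>. \<forall>C\<in>carrier (D Y). \<forall>C'\<in>carrier (D Y).
      congruence_closure X R `` C = congruence_closure X R `` C' \<longrightarrow> (\<exists>Z. (Y, Z) \<in> r \<and> \<phi> Y Z C = \<phi> Y Z C')"
  proof (intro ballI impI)
    fix Y C C' assume Y: "Y \<in> \<F>" and C: "C \<in> carrier (D Y)" "C' \<in> carrier (D Y)"
      and eq: "congruence_closure X R `` C = congruence_closure X R `` C'"
    obtain a b where a: "set_mset a \<subseteq> Y" "C = congruence_closure Y (restrict_relations Y R) `` {a}"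
      and b: "set_mset b \<subseteq> Y" "C' = congruence_closure Y (restrict_relations Y R) `` {b}"
      using C by (auto simp: D_def carrier_presented_monoid)
    have X: "set_mset a \<subseteq> X" "set_mset b \<subseteq> X" using a b sub[OF Y] by auto
    have "(a, b) \<in> congruence_closure X R"
      using eq im[OF Y] a b congruence_class_eq_iff[OF R X] by simp
    then obtain Z where Z: "Z \<in> \<F>" "(a, b) \<in> congruence_closure Z (restrict_relations Z R)"
      using congruence_in_member by blast
    obtain W where W: "W \<in> \<F>" "Y \<subseteq> W" "Z \<subseteq> W"
      using cofinal[of "Y \<union> Z"] members[OF Y] members[OF Z(1)] by auto
    have W': "set_mset a \<subseteq> W" "set_mset b \<subseteq> W" using a b W by auto
    have "(a, b) \<in> congruence_closure W (restrict_relations W R)"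
      using Z(2) by (rule restricted_congruence_mono[OF W(3)])
    then have "\<phi> Y W C = \<phi> Y W C'"
      unfolding \<phi>_def a(2) b(2)
      using a(1) b(1) W(2) congruence_class_eq_iff[OF restrict_relations_subset W']
      by (simp add: congruence_closure_Image_class restrict_relations_mono)
    then show "\<exists>Z. (Y, Z) \<in> r \<and> \<phi> Y Z C = \<phi> Y Z C'" using Y W by (auto simp: r_def)
  qed
qed

theorem tame_presented_monoid:
  assumes "refinement_monoid (presented_monoid X R)"
    and "\<And>Y. Y \<in> \<F> \<Longrightarrow> refinement_monoid (presented_monoid Y (restrict_relations Y R))"
  shows "tame (presented_monoid X R)"
  using assms(1) inductive_system_restrictions elementwise_limit_restrictions
proof (rule tame_elementwise_limit)
  fix Y assume "Y \<in> \<F>"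
  then show "finitely_generated_monoid (D Y)" "refinement_monoid (D Y)"
    using members[of Y] assms(2) presented_monoid_finitely_generated[OF restrict_relations_subset, of Y R]
    by (simp_all add: D_def)
qed

end

section \<open>Graph monoids\<close>

lemma range_sum_diff:
  assumes "finite W" "Z \<subseteq> W"
  shows "range_sum E Z + range_sum E (W - Z) = range_sum E W"
  unfolding range_sum_def using sum.subset_diff[OF assms(2,1)] by (metis add.commute)

lemma range_sum_nonempty: "finite Z \<Longrightarrow> Z \<noteq> {} \<Longrightarrow> range_sum E Z \<noteq> {#}"
  by (metis image_is_empty set_mset_eq_empty_iff set_mset_range_sum)

text \<open>
  Sets of generators over which the graph relations are still confluent: two ways of splitting
  finitely many arrows off an infinite emitter, given by \<open>Z\<close> and \<open>W\<close>, are joined by splitting off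
  \<open>Z \<union> W\<close>, and the step from \<open>Q Z\<close> to \<open>Q (Z \<union> W)\<close> produces ranges of arrows. A vertex
  whose relations leave the set is just not rewritten, like a sink.
\<close>

definition closed_generators :: "('v, 'e) pre_digraph \<Rightarrow> ('v, 'e) generator set \<Rightarrow> bool" where
  "closed_generators E Y \<longleftrightarrow> Y \<subseteq> graph_generators E \<and>
    (\<forall>Z e. Q Z \<in> Y \<longrightarrow> e \<in> Z \<longrightarrow> Vertex (head E e) \<in> Y) \<and>
    (\<forall>Z W v. Q Z \<in> Y \<longrightarrow> Q W \<in> Y \<longrightarrow> Z \<union> W \<subseteq> out_arcs E v \<longrightarrow> Q (Z \<union> W) \<in> Y)"

lemma Q_generatorD:
  assumes "closed_generators E Y" "Q Z \<in> Y"
  shows "finite Z" "Z \<noteq> {}"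
  using assms by (auto simp: closed_generators_def graph_generators_def)

lemma closed_generators_step:
  assumes Y: "closed_generators E Y" "Q Z \<in> Y" "Q W \<in> Y"
    and Z: "Z \<subseteq> W" "W \<subseteq> out_arcs E v" "infinite_emitter E v" and "set_mset c \<subseteq> Y"
  shows "rewrite_step Y (restrict_relations Y (graph_relations E))
    (c + {#Q Z#}) (c + range_sum E (W - Z) + {#Q W#})"
proof -
  have W: "finite W" "Z \<noteq> {}" using Q_generatorD Y by blast+
  have "({#Q Z#}, range_sum E (W - Z) + {#Q W#}) \<in> graph_relations E"
    unfolding graph_relations_def using Z W by blast
  moreover have "set_mset (range_sum E (W - Z)) \<subseteq> Y"
    using Y(1,3) W(1) by (auto simp: set_mset_range_sum closed_generators_def)
  ultimately have "({#Q Z#}, range_sum E (W - Z) + {#Q W#}) \<in> restrict_relations Y (graph_relations E)"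
    using Y by (simp add: restrict_relations_def)
  from rewrite_step.intros[OF this assms(7)] show ?thesis by (simp add: ac_simps)
qed

lemma graph_relations_nonempty:
  assumes "(a, b) \<in> graph_relations E"
  shows "a \<noteq> {#} \<and> b \<noteq> {#}"
  using assms unfolding graph_relations_def
  by (elim UnE CollectE exE conjE Pair_inject) (simp_all add: range_sum_nonempty)

text \<open>
  A vertex emitting finitely many arrows has one relation only. All other pairs of relations with the
  same left-hand side end in generators \<open>Q Z\<close> and \<open>Q W\<close> of one infinite emitter and meet
  in \<open>Q (Z \<union> W)\<close>.
\<close>

lemma context_free_closed_generators:
  assumes Y: "closed_generators E Y"
  shows "context_free_presentation Y (restrict_relations Y (graph_relations E))"
proof
  let ?R = "restrict_relations Y (graph_relations E)"
  show "?R \<subseteq> {a. set_mset a \<subseteq> Y} \<times> {a. set_mset a \<subseteq> Y}" by (rule restrict_relations_subset)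
  show "\<exists>x. l = {#x#}" if "(l, b) \<in> ?R" for l b
    using that by (auto simp: restrict_relations_def graph_relations_def)
  fix x b b' assume x: "({#x#}, b) \<in> ?R" "({#x#}, b') \<in> ?R"
  have bY: "set_mset b \<subseteq> Y" "set_mset b' \<subseteq> Y" using x by (auto simp: restrict_relations_def)
  have union: "Q (Z \<union> W) \<in> Y" if "Q Z \<in> Y" "Q W \<in> Y" "Z \<subseteq> out_arcs E v" "W \<subseteq> out_arcs E v" for Z W v
    using Y that unfolding closed_generators_def by (meson Un_least)
  show "\<exists>d. (rewrite_step Y ?R)\<^sup>=\<^sup>= b d \<and> (rewrite_step Y ?R)\<^sup>=\<^sup>= b' d"
  proof (cases x)
    case (Vertex v)
    have cases: "(finite (out_arcs E v) \<and> c = range_sum E (out_arcs E v)) \<or>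
      (infinite_emitter E v \<and> (\<exists>Z. Z \<subseteq> out_arcs E v \<and> finite Z \<and> Z \<noteq> {} \<and> c = range_sum E Z + {#Q Z#}))"
      if "({#x#}, c) \<in> ?R" for c
      using that Vertex by (auto simp: restrict_relations_def graph_relations_def)
    show ?thesis
    proof (cases "finite (out_arcs E v)")
      case True
      then have "b = b'" using cases[OF x(1)] cases[OF x(2)] by (auto simp: infinite_emitter_def)
      then show ?thesis by blast
    next
      case False
      obtain Z where Z: "infinite_emitter E v" "Z \<subseteq> out_arcs E v" "b = range_sum E Z + {#Q Z#}"
        using cases[OF x(1)] False by blast
      obtain W where W: "W \<subseteq> out_arcs E v" "b' = range_sum E W + {#Q W#}"
        using cases[OF x(2)] False by blast
      have q: "Q Z \<in> Y" "Q W \<in> Y" "Q (Z \<union> W) \<in> Y" using bY Z W union by simp_all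
      have fin: "finite (Z \<union> W)" using Q_generatorD[OF Y] q by blast
      have zw: "range_sum E Z + range_sum E (Z \<union> W - Z) = range_sum E (Z \<union> W)"
        "range_sum E W + range_sum E (Z \<union> W - W) = range_sum E (Z \<union> W)"
        by (intro range_sum_diff fin; blast)+
      have "rewrite_step Y ?R b (range_sum E (Z \<union> W) + {#Q (Z \<union> W)#})"
        using closed_generators_step[OF Y q(1,3) _ _ Z(1), of "range_sum E Z"] Z W bY zw(1) by simp
      moreover have "rewrite_step Y ?R b' (range_sum E (Z \<union> W) + {#Q (Z \<union> W)#})"
        using closed_generators_step[OF Y q(2,3) _ _ Z(1), of "range_sum E W"] Z W bY zw(2) by simp
      ultimately show ?thesis by blast
    qed
  next
    case (Q Z)
    have cases: "\<exists>v W. infinite_emitter E v \<and> Z \<subseteq> W \<and> W \<subseteq> out_arcs E v \<and> finite W \<and> Z \<noteq> {} \<and>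
        c = range_sum E (W - Z) + {#Q W#}"
      if "({#x#}, c) \<in> ?R" for c
    proof -
      have "({#generator.Q Z#}, c) \<in> graph_relations E" using that Q by (simp add: restrict_relations_def)
      then show ?thesis unfolding graph_relations_def by simp blast
    qed
    obtain v W where W: "infinite_emitter E v" "Z \<subseteq> W" "W \<subseteq> out_arcs E v" "finite W" "Z \<noteq> {}"
        "b = range_sum E (W - Z) + {#generator.Q W#}"
      using cases[OF x(1)] by blast
    obtain v' W' where W': "Z \<subseteq> W'" "W' \<subseteq> out_arcs E v'" "finite W'"
        "b' = range_sum E (W' - Z) + {#generator.Q W'#}"
      using cases[OF x(2)] by blast
    \<comment> \<open>The nonempty set \<open>Z\<close> determines the infinite emitter.\<close>
    obtain e where "e \<in> Z" using W(5) by blast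
    then have "e \<in> out_arcs E v" "e \<in> out_arcs E v'" using W(2,3) W'(1,2) by auto
    then have "v' = v" by simp
    then have W'v: "W' \<subseteq> out_arcs E v" using W'(2) by simp
    let ?U = "W \<union> W'"
    have q: "generator.Q W \<in> Y" "generator.Q W' \<in> Y" "generator.Q ?U \<in> Y"
      using bY W W' W'v union by simp_all
    have diffs: "?U - Z - (W - Z) = ?U - W" "?U - Z - (W' - Z) = ?U - W'"
      using W(2) W'(1) by auto
    have zw: "range_sum E (W - Z) + range_sum E (?U - W) = range_sum E (?U - Z)"
      "range_sum E (W' - Z) + range_sum E (?U - W') = range_sum E (?U - Z)"
      using range_sum_diff[of "?U - Z" "W - Z" E] range_sum_diff[of "?U - Z" "W' - Z" E] W(4) W'(3) diffs
      by auto
    have "rewrite_step Y ?R b (range_sum E (?U - Z) + {#generator.Q ?U#})"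
      using closed_generators_step[OF Y q(1,3) _ _ W(1), of "range_sum E (W - Z)"] W W'v bY zw(1) by simp
    moreover have "rewrite_step Y ?R b' (range_sum E (?U - Z) + {#generator.Q ?U#})"
      using closed_generators_step[OF Y q(2,3) _ _ W(1), of "range_sum E (W' - Z)"] W W' W'v bY zw(2) by simp
    ultimately show ?thesis by blast
  qed
qed

lemma closed_graph_generators:
  assumes "wf_digraph E"
  shows "closed_generators E (graph_generators E)"
proof -
  interpret wf_digraph E by fact
  show ?thesis unfolding closed_generators_def
  proof (intro conjI allI impI)
    fix Z e assume "Q Z \<in> graph_generators E" "e \<in> Z"
    then show "Vertex (head E e) \<in> graph_generators E" by (auto simp: graph_generators_def)
  next
    fix Z W v assume Q: "Q Z \<in> graph_generators E" "Q W \<in> graph_generators E" and v: "Z \<union> W \<subseteq> out_arcs E v"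
    then obtain w where w: "infinite_emitter E w" "Z \<subseteq> out_arcs E w" "finite Z" "Z \<noteq> {}" "finite W"
      by (auto simp: graph_generators_def)
    obtain e where "e \<in> Z" using w(4) by blast
    then have "e \<in> out_arcs E v" "e \<in> out_arcs E w" using v w(2) by auto
    then have "v = w" by simp
    then show "Q (Z \<union> W) \<in> graph_generators E"
      using w v unfolding graph_generators_def by blast
  qed simp
qed

text \<open>
  The arrows occurring in the members \<open>Q Z\<close> of \<open>F\<close> form a finite set \<open>A\<close>. Adding the ranges of
  the arrows in \<open>A\<close> and all generators \<open>Q Z\<close> with \<open>Z \<subseteq> A\<close> gives a closed set.
\<close>

lemma finite_closed_generators:
  assumes "wf_digraph E" "finite F" "F \<subseteq> graph_generators E"
  shows "\<exists>Y. finite Y \<and> closed_generators E Y \<and> F \<subseteq> Y"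
proof -
  interpret wf_digraph E by fact
  define A where "A = \<Union> {Z. Q Z \<in> F}"
  have "finite {Z. Q Z \<in> F}"
    using finite_vimageI[OF assms(2), of Q] by (simp add: vimage_def inj_def)
  moreover have "finite Z" if "Q Z \<in> F" for Z using that assms(3) by (auto simp: graph_generators_def)
  ultimately have A: "finite A" by (auto simp: A_def)
  define Y where "Y = {g \<in> graph_generators E. g \<in> F \<or> g \<in> (\<lambda>e. Vertex (head E e)) ` A \<or> g \<in> Q ` Pow A}"
  have "Y \<subseteq> F \<union> (\<lambda>e. Vertex (head E e)) ` A \<union> Q ` Pow A" by (auto simp: Y_def)
  then have "finite Y" by (rule finite_subset) (use A assms(2) in auto)
  have sub: "Z \<subseteq> A" if "Q Z \<in> Y" for Z using that by (auto simp: Y_def A_def)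
  note full = closed_graph_generators[OF assms(1)]
  have "closed_generators E Y" unfolding closed_generators_def
  proof (intro conjI allI impI)
    show "Y \<subseteq> graph_generators E" by (auto simp: Y_def)
    fix Z e assume "Q Z \<in> Y" "e \<in> Z"
    then show "Vertex (head E e) \<in> Y"
      using sub[of Z] full unfolding closed_generators_def Y_def by blast
  next
    fix Z W v assume Z: "Q Z \<in> Y" "Q W \<in> Y" "Z \<union> W \<subseteq> out_arcs E v"
    then have "Q (Z \<union> W) \<in> graph_generators E"
      using full unfolding closed_generators_def Y_def by blast
    moreover have "Q (Z \<union> W) \<in> Q ` Pow A" using sub[OF Z(1)] sub[OF Z(2)] by (intro imageI) simp
    ultimately show "Q (Z \<union> W) \<in> Y" unfolding Y_def by blast
  qed
  moreover have "F \<subseteq> Y" using assms(3) by (auto simp: Y_def)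
  ultimately show ?thesis using \<open>finite Y\<close> by blast
qed

lemma graph_relations_subset:
  assumes "wf_digraph E"
  shows "graph_relations E \<subseteq> {a. set_mset a \<subseteq> graph_generators E} \<times> {a. set_mset a \<subseteq> graph_generators E}"
proof
  have rs: "set_mset (range_sum E Z) \<subseteq> graph_generators E" if "finite Z" "Z \<subseteq> out_arcs E v" for Z v
    using that wf_digraph.head_in_verts[OF assms] by (auto simp: set_mset_range_sum graph_generators_def)
  have q: "Q Z \<in> graph_generators E"
    if "infinite_emitter E v" "Z \<subseteq> out_arcs E v" "finite Z" "Z \<noteq> {}" for Z v
    using that unfolding graph_generators_def by blast
  fix p assume "p \<in> graph_relations E"
  then consider
      v where "p = ({#Vertex v#}, range_sum E (out_arcs E v))" "v \<in> verts E" "finite (out_arcs E v)"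
    | v Z where "p = ({#Vertex v#}, range_sum E Z + {#Q Z#})" "infinite_emitter E v"
        "Z \<subseteq> out_arcs E v" "finite Z" "Z \<noteq> {}"
    | v Z W where "p = ({#Q Z#}, range_sum E (W - Z) + {#Q W#})" "infinite_emitter E v"
        "Z \<subseteq> W" "W \<subseteq> out_arcs E v" "finite W" "Z \<noteq> {}"
    unfolding graph_relations_def by blast
  then show "p \<in> {a. set_mset a \<subseteq> graph_generators E} \<times> {a. set_mset a \<subseteq> graph_generators E}"
  proof cases
    case (1 v)
    then show ?thesis using rs[of "out_arcs E v" v] by (simp add: graph_generators_def)
  next
    case (2 v Z)
    then have "v \<in> verts E" by (simp add: infinite_emitter_def)
    then have "Vertex v \<in> graph_generators E" by (simp add: graph_generators_def)
    then show ?thesis using 2 rs[of Z v] q by simp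
  next
    case (3 v Z W)
    have "finite Z" "Z \<subseteq> out_arcs E v" "W \<noteq> {}" "W - Z \<subseteq> out_arcs E v"
      using 3 by (auto intro: finite_subset)
    then show ?thesis using 3 rs[of "W - Z" v] q[of v Z] q[of v W] by simp
  qed
qed

theorem theorem3p1:
  fixes E :: "('v, 'e) pre_digraph"
  assumes "wf_digraph E"
  shows "refinement_monoid (graph_monoid E) \<and> tame (graph_monoid E) \<and>
    conical (graph_monoid E) \<and> unperforated (graph_monoid E) \<and> separative (graph_monoid E)"
proof -
  let ?X = "graph_generators E" and ?R = "graph_relations E"
  note R = graph_relations_subset[OF assms]
  have "restrict_relations ?X ?R = ?R" using R by (auto simp: restrict_relations_def)
  then interpret context_free_presentation ?X ?R
    using context_free_closed_generators[OF closed_graph_generators[OF assms]] by simp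
  have refinement: "refinement_monoid (graph_monoid E)"
    unfolding graph_monoid_def by (rule refinement_presented_monoid)
  have tame: "tame (graph_monoid E)"
    unfolding graph_monoid_def
  proof (rule tame_presented_monoid[of ?R ?X "{Y. finite Y \<and> closed_generators E Y}"])
    show "finite Y \<and> Y \<subseteq> ?X" if "Y \<in> {Y. finite Y \<and> closed_generators E Y}" for Y
      using that by (simp add: closed_generators_def)
    show "\<exists>Y\<in>{Y. finite Y \<and> closed_generators E Y}. F \<subseteq> Y" if "finite F" "F \<subseteq> ?X" for F
      using finite_closed_generators[OF assms that] by blast
    show "refinement_monoid (presented_monoid Y (restrict_relations Y ?R))"
      if "Y \<in> {Y. finite Y \<and> closed_generators E Y}" for Y
      using that context_free_presentation.refinement_presented_monoid context_free_closed_generators by blast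
  qed (use R refinement_presented_monoid in auto)
  have "conical (graph_monoid E)"
    unfolding graph_monoid_def using R graph_relations_nonempty by (rule presented_monoid_conical)
  then show ?thesis
    using refinement tame tame_unperforated[OF tame] tame_separative[OF tame] by blast
qed

end
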